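(* Let $\mathfrak{g}$ be a non-abelian real Lie algebra of dimension $2$, and let $w>0$ be an integer. For the weight-$w$ chain complex $C_\bullet^{[w]}$ of the Lie superalgebra $\overline{\mathfrak{g}}$ associated with $\mathfrak{g}$, one has \[ \begin{array}{c|ccc} m & w & w+1 & w+2\\\hline \dim C_m^{[w]} & 1 & 2 & 1\\ \dim\ker(\partial: C_m^{[w]}\to C_{m-1}^{[w]}) & 1 & 1 & 0\\ \text{$m$-th Betti number} & 0 & 0 & 0 \end{array} \]
   Context: For a finite dimensional real Lie algebra $\mathfrak{g}$ of dimension $n$, let $\overline{\mathfrak{g}}=\bigoplus_{i=0}^{n-1}\mathfrak{g}_i$ with $\mathfrak{g}_i=\Lambda^{i+1}\mathfrak{g}$ (elements of $\mathfrak{g}_i$ have grade $i$). It is a $\mathbb{Z}$-graded Lie superalgebra with the Schouten-like bracket: for $a=a_1\wedge\cdots\wedge a_k$ and $b=b_1\wedge\cdots\wedge b_l$ with $a_i,b_j\in\mathfrak{g}$, \[ [a,b]_S=\sum_{i,j}(-1)^{i+j}[a_i,b_j]\wedge a[i]\wedge b[j], \] where $a[i]$ (resp. $b[j]$) is $a$ (resp. $b$) with the factor $a_i$ (resp. $b_j$) omitted. Chains: take the quotient of the tensor algebra of the vector space $\overline{\mathfrak{g}}$ by the two-sided ideal generated by $X\otimes Y+(-1)^{xy}Y\otimes X$ for $X\in\mathfrak{g}_x$, $Y\in\mathfrak{g}_y$; denote the induced product by $\bigtriangleup$. (So factors of odd grade commute with each other, and factors of even grade anticommute with all homogeneous factors.)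 The space $C_m$ of $m$-chains is the image of the $m$-fold tensors. The weight of $Y_1\bigtriangleup\cdots\bigtriangleup Y_m$ with $Y_i\in\mathfrak{g}_{y_i}$ is $y_1+\cdots+y_m$, and $C_m^{[w]}\subset C_m$ is the subspace of chains of weight $w$. The boundary operator $\partial:C_m\to C_{m-1}$ is \[ \partial(Y_1\bigtriangleup\cdots\bigtriangleup Y_m)=\sum_{i<j}(-1)^{\,i-1+y_i\sum_{i<s<j}y_s}\;Y_1\bigtriangleup\cdots\widehat{Y_i}\cdots\bigtriangleup[Y_i,Y_j]_S\bigtriangleup\cdots\bigtriangleup Y_m, \] where $Y_i$ is omitted and $[Y_i,Y_j]_S$ is placed in the position of $Y_j$. It preserves weight and satisfies $\partial\circ\partial=0$. The $m$-th Betti number in weight $w$ is $\dim\bigl(\ker(\partial:C_m^{[w]}\to C_{m-1}^{[w]})/\partial(C_{m+1}^{[w]})\bigr)$. *)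

theory Defs
  imports "HOL-Analysis.Analysis" "HOL-Library.Poly_Mapping"
begin

section \<open>Free associative algebras and two-sided ideals\<close>

text \<open>
  With concatenation as addition of lists, the finitely supported functions
  \<open>'a list \<Rightarrow>\<^sub>0 real\<close> with the convolution product of \<^theory>\<open>HOL-Library.Poly_Mapping\<close>
  are the free unital associative real algebra on the set \<open>'a\<close>.
\<close>

instantiation list :: (type) monoid_add
begin
definition zero_list :: "'a list" where "0 = []"
definition plus_list :: "'a list \<Rightarrow> 'a list \<Rightarrow> 'a list" where "xs + ys = xs @ ys"
instance by standard (simp_all add: zero_list_def plus_list_def)
end

instantiation poly_mapping :: (type, real_vector) real_vector
begin

lift_definition scaleR_poly_mapping :: "real \<Rightarrow> ('a \<Rightarrow>\<^sub>0 'b) \<Rightarrow> 'a \<Rightarrow>\<^sub>0 'b"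
  is "\<lambda>c f k. c *\<^sub>R f k"
  by (erule rev_finite_subset) auto

instance
  by intro_classes (transfer; simp add: fun_eq_iff algebra_simps)+

end

lemma lookup_scaleR [simp]: "Poly_Mapping.lookup (c *\<^sub>R f) k = c *\<^sub>R Poly_Mapping.lookup f k"
  by transfer rule

instance poly_mapping :: (monoid_add, real_algebra_1) real_algebra_1
proof
  have left: "Poly_Mapping.single 0 (of_real c) * f = c *\<^sub>R f" for c and f :: "'a \<Rightarrow>\<^sub>0 'b"
    by (rule poly_mapping_eqI) (simp add: lookup_mult lookup_single when_mult scaleR_conv_of_real)
  have right: "f * Poly_Mapping.single 0 (of_real c) = c *\<^sub>R f" for c and f :: "'a \<Rightarrow>\<^sub>0 'b"
  proof (rule poly_mapping_eqI)
    fix k :: 'a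
    have "Sum_any (\<lambda>q. ((of_real c :: 'b) when 0 = q) when k = l + q) = (of_real c when l = k :: 'b)" for l
    proof -
      have "Sum_any (\<lambda>q. ((of_real c :: 'b) when 0 = q) when k = l + q) =
            Sum_any (\<lambda>q::'a. ((of_real c :: 'b) when l = k) when q = 0)"
        by (rule Sum_any.cong) (auto simp: when_def)
      then show ?thesis
        by simp
    qed
    then show "Poly_Mapping.lookup (f * Poly_Mapping.single 0 (of_real c)) k =
               Poly_Mapping.lookup (c *\<^sub>R f) k"
      by (simp add: lookup_mult lookup_single mult_when of_real_def)
  qed
  fix c :: real and f g :: "'a \<Rightarrow>\<^sub>0 'b"
  show "c *\<^sub>R f * g = c *\<^sub>R (f * g)"
    by (simp flip: left add: mult.assoc)
  show "f * c *\<^sub>R g = c *\<^sub>R (f * g)"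
    by (metis left right mult.assoc)
qed

definition two_sided_ideal :: "'a::ring_1 set \<Rightarrow> bool" where
  "two_sided_ideal I \<longleftrightarrow>
     0 \<in> I \<and> (\<forall>x\<in>I. \<forall>y\<in>I. x + y \<in> I) \<and> (\<forall>x\<in>I. \<forall>a. a * x \<in> I \<and> x * a \<in> I)"

abbreviation ideal_generated :: "'a::ring_1 set \<Rightarrow> 'a set" where
  "ideal_generated S \<equiv> two_sided_ideal hull S"

lemma two_sided_ideal_generated: "two_sided_ideal (ideal_generated S)"
  by (rule hull_in) (auto simp: two_sided_ideal_def)

definition ideal_cong :: "'a::ring_1 set \<Rightarrow> 'a \<Rightarrow> 'a \<Rightarrow> bool" where
  "ideal_cong S x y \<longleftrightarrow> x - y \<in> ideal_generated S"

context
  fixes S :: "'a::real_algebra_1 set"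
begin

lemma ideal_generated_0: "0 \<in> ideal_generated S"
  and ideal_generated_add: "x \<in> ideal_generated S \<Longrightarrow> y \<in> ideal_generated S \<Longrightarrow> x + y \<in> ideal_generated S"
  and ideal_generated_mult_left: "x \<in> ideal_generated S \<Longrightarrow> a * x \<in> ideal_generated S"
  and ideal_generated_mult_right: "x \<in> ideal_generated S \<Longrightarrow> x * a \<in> ideal_generated S"
  using two_sided_ideal_generated[of S] by (auto simp: two_sided_ideal_def)

lemma ideal_generated_uminus: "x \<in> ideal_generated S \<Longrightarrow> - x \<in> ideal_generated S"
  using ideal_generated_mult_left[of x "- 1"] by simp

lemma ideal_generated_scaleR: "x \<in> ideal_generated S \<Longrightarrow> c *\<^sub>R x \<in> ideal_generated S"
  using ideal_generated_mult_left[of x "of_real c"] by (simp add: of_real_def)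

lemma equivp_ideal_cong: "equivp (ideal_cong S)"
proof (rule equivpI)
  show "reflp (ideal_cong S)"
    by (simp add: reflp_def ideal_cong_def ideal_generated_0)
  show "symp (ideal_cong S)"
    using ideal_generated_uminus by (fastforce simp: symp_def ideal_cong_def)
  show "transp (ideal_cong S)"
    using ideal_generated_add by (fastforce simp: transp_def ideal_cong_def)
qed

lemma ideal_cong_refl: "ideal_cong S x x"
  by (simp add: ideal_cong_def ideal_generated_0)

lemma ideal_cong_add: "ideal_cong S x x' \<Longrightarrow> ideal_cong S y y' \<Longrightarrow> ideal_cong S (x + y) (x' + y')"
  using ideal_generated_add[of "x - x'" "y - y'"] by (simp add: ideal_cong_def algebra_simps)

lemma ideal_cong_uminus: "ideal_cong S x x' \<Longrightarrow> ideal_cong S (- x) (- x')"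
  using ideal_generated_uminus[of "x - x'"] by (simp add: ideal_cong_def algebra_simps)

lemma ideal_cong_diff: "ideal_cong S x x' \<Longrightarrow> ideal_cong S y y' \<Longrightarrow> ideal_cong S (x - y) (x' - y')"
  using ideal_cong_add[of x x' "- y" "- y'"] ideal_cong_uminus[of y y'] by simp

lemma ideal_cong_scaleR: "ideal_cong S x x' \<Longrightarrow> ideal_cong S (c *\<^sub>R x) (c *\<^sub>R x')"
  using ideal_generated_scaleR[of "x - x'" c] by (simp add: ideal_cong_def algebra_simps)

lemma ideal_cong_mult:
  assumes "ideal_cong S x x'" "ideal_cong S y y'"
  shows "ideal_cong S (x * y) (x' * y')"
proof -
  have "x * y - x' * y' = (x - x') * y + x' * (y - y')"
    by (simp add: algebra_simps)
  then show ?thesis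
    using assms ideal_generated_add ideal_generated_mult_left ideal_generated_mult_right
    by (metis ideal_cong_def)
qed

end

text \<open>
  Augmentations are used only to see that the quotient algebras below are nontrivial,
  as the class \<^class>\<open>real_algebra_1\<close> demands.
\<close>

definition augmentation :: "('a::real_algebra_1 \<Rightarrow> real) \<Rightarrow> bool" where
  "augmentation e \<longleftrightarrow>
     (\<forall>x y. e (x + y) = e x + e y) \<and> (\<forall>x y. e (x * y) = e x * e y) \<and> e 1 = 1"

lemma augmentation_vanishes:
  assumes "augmentation e" "\<And>s. s \<in> S \<Longrightarrow> e s = 0" "x \<in> ideal_generated S"
  shows "e x = 0"
proof -
  have "e 0 = 0"
    using assms(1) by (metis add.right_neutral add_cancel_left_right augmentation_def)
  with assms(1) have "two_sided_ideal {x. e x = 0}"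
    by (simp add: two_sided_ideal_def augmentation_def)
  then show ?thesis
    using hull_induct[of x two_sided_ideal S "\<lambda>x. e x = 0"] assms(2,3) by simp
qed

lemma augmentation_diff:
  assumes "augmentation e" shows "e (x - y) = e x - e y"
  using assms by (metis add_diff_cancel_right' diff_add_cancel augmentation_def)

lemma augmentation_scaleR:
  assumes "augmentation e" "e x = 0" shows "e (c *\<^sub>R x) = 0"
proof -
  have "e (of_real c * x) = 0"
    using assms by (simp add: augmentation_def)
  then show ?thesis by (simp add: of_real_def)
qed

lemma augmentation_ideal_cong:
  assumes "augmentation e" "\<And>s. s \<in> S \<Longrightarrow> e s = 0" "ideal_cong S x y"
  shows "e x = e y"
  using augmentation_vanishes[of e S "x - y"] assms
  by (auto simp: ideal_cong_def augmentation_diff)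

lemma augmentation_free: "augmentation (\<lambda>f :: 'a list \<Rightarrow>\<^sub>0 real. Poly_Mapping.lookup f 0)"
proof -
  have "Poly_Mapping.lookup (f * g) 0 = Poly_Mapping.lookup f 0 * Poly_Mapping.lookup g 0"
    for f g :: "'a list \<Rightarrow>\<^sub>0 real"
  proof -
    have "Sum_any (\<lambda>q. Poly_Mapping.lookup g q when 0 = l + q) = (Poly_Mapping.lookup g 0 when l = 0)"
      for l :: "'a list"
    proof -
      have "Sum_any (\<lambda>q. Poly_Mapping.lookup g q when 0 = l + q) =
            Sum_any (\<lambda>q::'a list. (Poly_Mapping.lookup g 0 when l = 0) when q = 0)"
        by (rule Sum_any.cong) (auto simp: when_def plus_list_def zero_list_def)
      then show ?thesis by simp
    qed
    then show ?thesis
      by (simp add: lookup_mult mult_when)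
  qed
  then show ?thesis
    by (simp add: augmentation_def lookup_add lookup_one)
qed


section \<open>The tensor algebra of a real vector space\<close>

definition free_gen :: "'a \<Rightarrow> 'a list \<Rightarrow>\<^sub>0 real" where
  "free_gen v = Poly_Mapping.single [v] 1"

definition tensor_relations :: "('a::real_vector list \<Rightarrow>\<^sub>0 real) set" where
  "tensor_relations =
     {free_gen (u + v) - (free_gen u + free_gen v) | u v. True} \<union>
     {free_gen (c *\<^sub>R v) - c *\<^sub>R free_gen v | c v. True}"

quotient_type (overloaded) 'a tensor_algebra =
  "'a::real_vector list \<Rightarrow>\<^sub>0 real" / "ideal_cong tensor_relations"
  by (rule equivp_ideal_cong)

lift_definition tensor_augmentation :: "'a::real_vector tensor_algebra \<Rightarrow> real"
  is "\<lambda>f. Poly_Mapping.lookup f 0"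
  by (rule augmentation_ideal_cong[OF augmentation_free])
     (auto simp: tensor_relations_def free_gen_def lookup_minus lookup_add lookup_single
        zero_list_def)

instantiation tensor_algebra :: (real_vector) real_algebra_1
begin

lift_definition zero_tensor_algebra :: "'a tensor_algebra" is 0 .
lift_definition one_tensor_algebra :: "'a tensor_algebra" is 1 .
lift_definition plus_tensor_algebra :: "'a tensor_algebra \<Rightarrow> 'a tensor_algebra \<Rightarrow> 'a tensor_algebra"
  is "(+)" by (rule ideal_cong_add)
lift_definition uminus_tensor_algebra :: "'a tensor_algebra \<Rightarrow> 'a tensor_algebra"
  is uminus by (rule ideal_cong_uminus)
lift_definition minus_tensor_algebra :: "'a tensor_algebra \<Rightarrow> 'a tensor_algebra \<Rightarrow> 'a tensor_algebra"
  is "(-)" by (rule ideal_cong_diff)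
lift_definition times_tensor_algebra :: "'a tensor_algebra \<Rightarrow> 'a tensor_algebra \<Rightarrow> 'a tensor_algebra"
  is "(*)" by (rule ideal_cong_mult)
lift_definition scaleR_tensor_algebra :: "real \<Rightarrow> 'a tensor_algebra \<Rightarrow> 'a tensor_algebra"
  is scaleR by (rule ideal_cong_scaleR)

instance
proof
  have "tensor_augmentation 0 = 0" "tensor_augmentation 1 = 1"
    by (transfer; simp add: lookup_one)+
  then show "(0::'a tensor_algebra) \<noteq> 1"
    by (metis zero_neq_one)
qed (transfer; simp add: algebra_simps ideal_cong_refl)+

end

lemma augmentation_tensor: "augmentation tensor_augmentation"
  unfolding augmentation_def
  by (transfer; use augmentation_free in \<open>simp add: augmentation_def\<close>)

definition tensor_of :: "'a::real_vector \<Rightarrow> 'a tensor_algebra" where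
  "tensor_of v = abs_tensor_algebra (free_gen v)"

lemma tensor_augmentation_tensor_of [simp]: "tensor_augmentation (tensor_of v) = 0"
  by (simp add: tensor_of_def tensor_augmentation.abs_eq free_gen_def lookup_single zero_list_def)

lemma tensor_augmentation_mult:
  "tensor_augmentation (x * y) = tensor_augmentation x * tensor_augmentation y"
  using augmentation_tensor unfolding augmentation_def by blast

lemma tensor_augmentation_add:
  "tensor_augmentation (x + y) = tensor_augmentation x + tensor_augmentation y"
  using augmentation_tensor unfolding augmentation_def by blast

definition tensor_power :: "nat \<Rightarrow> 'a::real_vector tensor_algebra set" where
  "tensor_power m = span {prod_list (map tensor_of vs) | vs. length vs = m}"


section \<open>The exterior algebra\<close>

definition exterior_relations :: "'a::real_vector tensor_algebra set" where
  "exterior_relations = {tensor_of v * tensor_of v | v. True}"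

quotient_type (overloaded) 'a exterior_algebra =
  "'a::real_vector tensor_algebra" / "ideal_cong exterior_relations"
  by (rule equivp_ideal_cong)

lift_definition exterior_augmentation :: "'a::real_vector exterior_algebra \<Rightarrow> real"
  is tensor_augmentation
  by (rule augmentation_ideal_cong[OF augmentation_tensor])
     (auto simp: exterior_relations_def tensor_augmentation_mult)

instantiation exterior_algebra :: (real_vector) real_algebra_1
begin

lift_definition zero_exterior_algebra :: "'a exterior_algebra" is 0 .
lift_definition one_exterior_algebra :: "'a exterior_algebra" is 1 .
lift_definition plus_exterior_algebra ::
  "'a exterior_algebra \<Rightarrow> 'a exterior_algebra \<Rightarrow> 'a exterior_algebra"
  is "(+)" by (rule ideal_cong_add)
lift_definition uminus_exterior_algebra :: "'a exterior_algebra \<Rightarrow> 'a exterior_algebra"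
  is uminus by (rule ideal_cong_uminus)
lift_definition minus_exterior_algebra ::
  "'a exterior_algebra \<Rightarrow> 'a exterior_algebra \<Rightarrow> 'a exterior_algebra"
  is "(-)" by (rule ideal_cong_diff)
lift_definition times_exterior_algebra ::
  "'a exterior_algebra \<Rightarrow> 'a exterior_algebra \<Rightarrow> 'a exterior_algebra"
  is "(*)" by (rule ideal_cong_mult)
lift_definition scaleR_exterior_algebra :: "real \<Rightarrow> 'a exterior_algebra \<Rightarrow> 'a exterior_algebra"
  is scaleR by (rule ideal_cong_scaleR)

instance
proof
  have "exterior_augmentation 0 = 0" "exterior_augmentation 1 = 1"
    by (transfer; transfer; simp add: lookup_one)+
  then show "(0::'a exterior_algebra) \<noteq> 1"
    by (metis zero_neq_one)
qed (transfer; simp add: algebra_simps ideal_cong_refl)+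

end

text \<open>\<open>wedge [a\<^sub>1, \<dots>, a\<^sub>k]\<close> is \<open>a\<^sub>1 \<and> \<dots> \<and> a\<^sub>k\<close>.\<close>

definition wedge :: "'a::real_vector list \<Rightarrow> 'a exterior_algebra" where
  "wedge vs = prod_list (map (\<lambda>v. abs_exterior_algebra (tensor_of v)) vs)"

definition exterior_power :: "nat \<Rightarrow> 'a::real_vector exterior_algebra set" where
  "exterior_power k = abs_exterior_algebra ` tensor_power k"


section \<open>The graded space of multivectors\<close>

text \<open>
  For \<open>'a\<close> of finite dimension \<open>n\<close>, the type \<open>'a multivector\<close> is
  \<open>\<Lambda>\<^sup>1 \<oplus> \<dots> \<oplus> \<Lambda>\<^sup>n\<close>, realised as an internal sum inside the exterior algebra.
\<close>

typedef (overloaded) 'a multivector =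
  "span (\<Union>i<dim (UNIV::'a set). exterior_power (Suc i)) :: 'a::real_vector exterior_algebra set"
  using span_zero by blast

setup_lifting type_definition_multivector

instantiation multivector :: (real_vector) real_vector
begin

lift_definition zero_multivector :: "'a multivector" is 0 by (rule span_zero)
lift_definition plus_multivector :: "'a multivector \<Rightarrow> 'a multivector \<Rightarrow> 'a multivector"
  is "(+)" by (rule span_add)
lift_definition uminus_multivector :: "'a multivector \<Rightarrow> 'a multivector"
  is uminus by (rule span_neg)
lift_definition minus_multivector :: "'a multivector \<Rightarrow> 'a multivector \<Rightarrow> 'a multivector"
  is "(-)" by (rule span_diff)
lift_definition scaleR_multivector :: "real \<Rightarrow> 'a multivector \<Rightarrow> 'a multivector"
  is scaleR by (rule span_scale)

instance
  by standard (transfer; simp add: algebra_simps)+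

end

definition grade_space :: "nat \<Rightarrow> 'a::real_vector multivector set" where
  "grade_space i = {X. Rep_multivector X \<in> exterior_power (Suc i)}"


section \<open>Lie algebras and the Schouten bracket\<close>

locale real_lie_algebra =
  fixes br :: "'a::real_vector \<Rightarrow> 'a \<Rightarrow> 'a"
  assumes bilinear_br: "bilinear br"
    and alternating: "br x x = 0"
    and jacobi: "br x (br y z) + br y (br z x) + br z (br x y) = 0"

definition abelian :: "('a::real_vector \<Rightarrow> 'a \<Rightarrow> 'a) \<Rightarrow> bool" where
  "abelian br \<longleftrightarrow> (\<forall>x y. br x y = 0)"

definition omit :: "nat \<Rightarrow> 'a list \<Rightarrow> 'a list" where
  "omit i xs = take i xs @ drop (Suc i) xs"

text \<open>
  Wedges of nonempty lists span, so the following description determines at most one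
  bilinear map. Indices start at \<open>0\<close>, which does not change the parity of \<open>i + j\<close>.
\<close>

definition schouten ::
  "('a::real_vector \<Rightarrow> 'a \<Rightarrow> 'a) \<Rightarrow> 'a multivector \<Rightarrow> 'a multivector \<Rightarrow> 'a multivector" where
  "schouten br = (THE B. bilinear B \<and>
     (\<forall>X Y as bs. as \<noteq> [] \<longrightarrow> bs \<noteq> [] \<longrightarrow>
        Rep_multivector X = wedge as \<longrightarrow> Rep_multivector Y = wedge bs \<longrightarrow>
        Rep_multivector (B X Y) =
          (\<Sum>i<length as. \<Sum>j<length bs.
             (-1) ^ (i + j) *\<^sub>R wedge (br (as ! i) (bs ! j) # omit i as @ omit j bs))))"


section \<open>Chains of the Lie superalgebra of multivectors\<close>

definition chain_relations :: "'a::real_vector multivector tensor_algebra set" where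
  "chain_relations =
     {tensor_of X * tensor_of Y + (-1) ^ (x * y) *\<^sub>R (tensor_of Y * tensor_of X) | x y X Y.
        X \<in> grade_space x \<and> Y \<in> grade_space y}"

quotient_type (overloaded) 'a chain_algebra =
  "'a::real_vector multivector tensor_algebra" / "ideal_cong chain_relations"
  by (rule equivp_ideal_cong)

lift_definition chain_augmentation :: "'a::real_vector chain_algebra \<Rightarrow> real"
  is tensor_augmentation
proof (rule augmentation_ideal_cong[OF augmentation_tensor])
  fix s :: "'a multivector tensor_algebra"
  assume "s \<in> chain_relations"
  then obtain x y :: nat and X Y :: "'a multivector"
    where s: "s = tensor_of X * tensor_of Y + (-1) ^ (x * y) *\<^sub>R (tensor_of Y * tensor_of X)"
    unfolding chain_relations_def by blast
  have "tensor_augmentation (tensor_of U * tensor_of V) = 0" for U V :: "'a multivector"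
    by (simp add: tensor_augmentation_mult)
  then show "tensor_augmentation s = 0"
    by (simp add: s tensor_augmentation_add augmentation_scaleR[OF augmentation_tensor])
qed

instantiation chain_algebra :: (real_vector) real_algebra_1
begin

lift_definition zero_chain_algebra :: "'a chain_algebra" is 0 .
lift_definition one_chain_algebra :: "'a chain_algebra" is 1 .
lift_definition plus_chain_algebra :: "'a chain_algebra \<Rightarrow> 'a chain_algebra \<Rightarrow> 'a chain_algebra"
  is "(+)" by (rule ideal_cong_add)
lift_definition uminus_chain_algebra :: "'a chain_algebra \<Rightarrow> 'a chain_algebra"
  is uminus by (rule ideal_cong_uminus)
lift_definition minus_chain_algebra :: "'a chain_algebra \<Rightarrow> 'a chain_algebra \<Rightarrow> 'a chain_algebra"
  is "(-)" by (rule ideal_cong_diff)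
lift_definition times_chain_algebra :: "'a chain_algebra \<Rightarrow> 'a chain_algebra \<Rightarrow> 'a chain_algebra"
  is "(*)" by (rule ideal_cong_mult)
lift_definition scaleR_chain_algebra :: "real \<Rightarrow> 'a chain_algebra \<Rightarrow> 'a chain_algebra"
  is scaleR by (rule ideal_cong_scaleR)

instance
proof
  have "chain_augmentation 0 = 0" "chain_augmentation 1 = 1"
    by (transfer; transfer; simp add: lookup_one)+
  then show "(0::'a chain_algebra) \<noteq> 1"
    by (metis zero_neq_one)
qed (transfer; simp add: algebra_simps ideal_cong_refl)+

end

text \<open>\<open>chain_prod [Y\<^sub>1, \<dots>, Y\<^sub>m]\<close> is \<open>Y\<^sub>1 \<triangle> \<dots> \<triangle> Y\<^sub>m\<close>.\<close>

definition chain_prod :: "'a::real_vector multivector list \<Rightarrow> 'a chain_algebra" where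
  "chain_prod Ys = prod_list (map (\<lambda>Y. abs_chain_algebra (tensor_of Y)) Ys)"

definition chains :: "nat \<Rightarrow> 'a::real_vector chain_algebra set" where
  "chains m = abs_chain_algebra ` tensor_power m"

text \<open>\<open>has_grades Ys ys\<close>: the factors in \<open>Ys\<close> are homogeneous, of the grades listed in \<open>ys\<close>.\<close>

definition has_grades :: "'a::real_vector multivector list \<Rightarrow> nat list \<Rightarrow> bool" where
  "has_grades Ys ys \<longleftrightarrow> list_all2 (\<lambda>Y y. Y \<in> grade_space y) Ys ys"

definition weight_chains :: "nat \<Rightarrow> nat \<Rightarrow> 'a::real_vector chain_algebra set" where
  "weight_chains m w =
     span {chain_prod Ys | Ys ys. has_grades Ys ys \<and> length Ys = m \<and> sum_list ys = w}"

lemma weight_chains_subset_chains: "weight_chains m w \<subseteq> chains m"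
proof -
  have "linear (abs_chain_algebra :: 'a multivector tensor_algebra \<Rightarrow> 'a chain_algebra)"
    by (rule linearI) (simp_all add: plus_chain_algebra.abs_eq scaleR_chain_algebra.abs_eq)
  then have "subspace (chains m :: 'a chain_algebra set)"
    unfolding chains_def tensor_power_def by (intro linear_subspace_image subspace_span)
  moreover have "chain_prod Ys = abs_chain_algebra (prod_list (map tensor_of Ys))"
    for Ys :: "'a multivector list"
    by (induction Ys)
       (simp_all add: chain_prod_def one_chain_algebra.abs_eq times_chain_algebra.abs_eq)
  then have "chain_prod Ys \<in> chains (length Ys)" for Ys :: "'a multivector list"
    unfolding chains_def tensor_power_def by (force intro: span_base)
  ultimately show ?thesis
    unfolding weight_chains_def by (intro span_minimal) auto
qed

text \<open>
  Products of homogeneous factors span the chain algebra, so there is at most one such linear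
  map on the sum of all \<open>C\<^sub>m\<close>. With indices starting at \<open>0\<close>, the exponent \<open>i - 1\<close> becomes \<open>i\<close>.
\<close>

definition boundary ::
  "('a::real_vector \<Rightarrow> 'a \<Rightarrow> 'a) \<Rightarrow> 'a chain_algebra \<Rightarrow> 'a chain_algebra" where
  "boundary br = (THE D. linear D \<and>
     (\<forall>Ys ys. has_grades Ys ys \<longrightarrow>
        D (chain_prod Ys) =
          (\<Sum>j<length Ys. \<Sum>i<j.
             (-1) ^ (i + ys ! i * (\<Sum>s\<in>{i<..<j}. ys ! s)) *\<^sub>R
               chain_prod (omit i (Ys[j := schouten br (Ys ! i) (Ys ! j)])))))"


section \<open>Homology\<close>

text \<open>
  For subspaces \<open>B \<subseteq> Z\<close>, a set \<open>S\<close> is a \<open>quotient_basis Z B\<close> if the cosets \<open>s + B\<close> of its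
  elements are distinct and form a basis of \<open>Z / B\<close>.
\<close>

definition quotient_basis :: "'a::real_vector set \<Rightarrow> 'a set \<Rightarrow> 'a set \<Rightarrow> bool" where
  "quotient_basis Z B S \<longleftrightarrow>
     S \<subseteq> Z \<and>
     (\<forall>T c. finite T \<longrightarrow> T \<subseteq> S \<longrightarrow> (\<Sum>t\<in>T. c t *\<^sub>R t) \<in> B \<longrightarrow> (\<forall>t\<in>T. c t = 0)) \<and>
     (\<forall>z\<in>Z. \<exists>s\<in>span S. z - s \<in> B)"

definition quotient_dim :: "'a::real_vector set \<Rightarrow> 'a set \<Rightarrow> nat" where
  "quotient_dim Z B = card (SOME S. quotient_basis Z B S)"

definition cycles ::
  "('a::real_vector \<Rightarrow> 'a \<Rightarrow> 'a) \<Rightarrow> nat \<Rightarrow> nat \<Rightarrow> 'a chain_algebra set" where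
  "cycles br m w = {c \<in> weight_chains m w. boundary br c = 0}"

definition boundaries ::
  "('a::real_vector \<Rightarrow> 'a \<Rightarrow> 'a) \<Rightarrow> nat \<Rightarrow> nat \<Rightarrow> 'a chain_algebra set" where
  "boundaries br m w = boundary br ` weight_chains (Suc m) w"

definition betti :: "('a::real_vector \<Rightarrow> 'a \<Rightarrow> 'a) \<Rightarrow> nat \<Rightarrow> nat \<Rightarrow> nat" where
  "betti br m w = quotient_dim (cycles br m w) (boundaries br m w)"

end

theory Submission
  imports Defs
begin

text \<open>
  A nonabelian plane has a basis \<open>e, f\<close> with \<open>[e, f] = f\<close>. Put \<open>u = e \<and> f\<close>. Then
  \<open>\<Lambda>\<^sup>1 \<oplus> \<Lambda>\<^sup>2\<close> has the basis \<open>e, f\<close> (grade 0) and \<open>u\<close> (grade 1), all higher exterior powers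
  vanish, and the Schouten bracket is given by \<open>[e, f] = f\<close>, \<open>[e, u] = u\<close>, \<open>[f, u] = [u, u] = 0\<close>.
  In the chain algebra \<open>e\<close> and \<open>f\<close> square to zero, the three generators anticommute with each other,
  and \<open>u\<close> has independent powers, so the monomials \<open>e\<^sup>a f\<^sup>b u\<^sup>k\<close> with \<open>a, b \<in> {0, 1}\<close> form a basis. Such a monomial has
  weight \<open>k\<close> and length \<open>a + b + k\<close>, which gives the dimensions 1, 2, 1 of the chain spaces.
  The boundary operator satisfies
  \[ \partial(e f u^k) = (k + 1) f u^k, \quad \partial(e u^k) = k u^k, \quad
     \partial(f u^k) = \partial(u^k) = 0, \]
  so that for \<open>k = w > 0\<close> the complex is exact.

  The work lies in turning these formulas into statements about iterated quotients of free
  algebras. That the monomials are independent cannot be read off from generators and relations; it is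
  shown by letting the algebras act on a space \<open>model\<close> with basis the symbols \<open>e\<^sup>a f\<^sup>b u\<^sup>k\<close>
  (\<open>exterior_act\<close>, \<open>chain_act\<close>). Applying a chain to the symbol \<open>1\<close> identifies the chain
  algebra with the model (\<open>of_to_model\<close>, \<open>to_model_monomial\<close>). The bracket and the boundary
  operator are described as the unique linear or bilinear maps with a certain property, so both
  existence and uniqueness are needed. For the boundary operator, existence is the statement that
  the alternating sum over pairs \<open>i < j\<close> depends on the product of the factors only. The sum obeys
  the recursion \<open>\<partial>(Z c) = ad\<^sub>Z(c) - Z \<partial>(c)\<close>, where \<open>ad\<^sub>Z\<close> is the superderivation
  extending the bracket with \<open>Z\<close> (\<open>boundary_sum_Cons\<close>, \<open>ad_sum_Cons\<close>), and the operators
  defined on the model by the formulas above obey the same recursions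
  (\<open>model_boundary_chain_op\<close>, \<open>ad_chain_op\<close>).
\<close>

section \<open>Actions of the tensor, exterior and chain algebras\<close>

definition lin_ext :: "('k \<Rightarrow> 'v::real_vector) \<Rightarrow> ('k \<Rightarrow>\<^sub>0 real) \<Rightarrow> 'v" where
  "lin_ext f p = (\<Sum>k\<in>Poly_Mapping.keys p. Poly_Mapping.lookup p k *\<^sub>R f k)"

lemma lin_ext_superset:
  assumes "finite A" "Poly_Mapping.keys p \<subseteq> A"
  shows "lin_ext f p = (\<Sum>k\<in>A. Poly_Mapping.lookup p k *\<^sub>R f k)"
  unfolding lin_ext_def using assms
  by (intro sum.mono_neutral_left) (auto simp: in_keys_iff)

lemma linear_lin_ext: "linear (lin_ext f)"
proof (rule linearI)
  fix p q :: "'a \<Rightarrow>\<^sub>0 real" and c :: real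
  let ?A = "Poly_Mapping.keys p \<union> Poly_Mapping.keys q \<union> Poly_Mapping.keys (p + q)"
  have "lin_ext f r = (\<Sum>k\<in>?A. Poly_Mapping.lookup r k *\<^sub>R f k)" if "r \<in> {p, q, p + q}" for r
    using that by (intro lin_ext_superset) auto
  then show "lin_ext f (p + q) = lin_ext f p + lin_ext f q"
    by (simp add: lookup_add scaleR_left_distrib sum.distrib)
  have "Poly_Mapping.keys (c *\<^sub>R p) \<subseteq> Poly_Mapping.keys p"
    by (auto simp: in_keys_iff)
  then have "lin_ext f (c *\<^sub>R p) =
      (\<Sum>k\<in>Poly_Mapping.keys p. Poly_Mapping.lookup (c *\<^sub>R p) k *\<^sub>R f k)"
    by (intro lin_ext_superset) auto
  then show "lin_ext f (c *\<^sub>R p) = c *\<^sub>R lin_ext f p"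
    by (simp add: lin_ext_def scaleR_sum_right)
qed

lemma lin_ext_single [simp]: "lin_ext f (Poly_Mapping.single k 1) = f k"
  by (simp add: lin_ext_def)

lemma poly_mapping_eq_sum_single:
  "p = (\<Sum>k\<in>Poly_Mapping.keys p. Poly_Mapping.lookup p k *\<^sub>R Poly_Mapping.single k (1::real))"
proof (rule poly_mapping_eqI)
  fix j
  have "(\<Sum>k\<in>Poly_Mapping.keys p. Poly_Mapping.lookup p k * (1 when k = j)) =
      (\<Sum>k\<in>Poly_Mapping.keys p. if k = j then Poly_Mapping.lookup p k else 0)"
    by (rule sum.cong) (auto simp: when_def)
  then show "Poly_Mapping.lookup p j = Poly_Mapping.lookup
      (\<Sum>k\<in>Poly_Mapping.keys p. Poly_Mapping.lookup p k *\<^sub>R Poly_Mapping.single k (1::real)) j"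
    by (auto simp: lookup_sum lookup_single in_keys_iff)
qed

lemma linear_eq_on_singles:
  fixes f g :: "('k \<Rightarrow>\<^sub>0 real) \<Rightarrow> 'v::real_vector"
  assumes "linear f" "linear g"
    and "\<And>k. f (Poly_Mapping.single k 1) = g (Poly_Mapping.single k 1)"
  shows "f p = g p"
proof -
  have "h p = (\<Sum>k\<in>Poly_Mapping.keys p. Poly_Mapping.lookup p k *\<^sub>R h (Poly_Mapping.single k 1))"
    if "linear h" for h :: "('k \<Rightarrow>\<^sub>0 real) \<Rightarrow> 'v"
    by (subst (1) poly_mapping_eq_sum_single) (simp add: linear_sum[OF that] linear_scale[OF that])
  from this[OF assms(1)] this[OF assms(2)] show ?thesis
    by (simp add: assms(3))
qed

text \<open>
  A representation of an algebra, in uncurried form. Representations are used to prove that elements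
  of a quotient algebra are nonzero or independent.
\<close>

definition algebra_action :: "('a::real_algebra_1 \<Rightarrow> 'w::real_vector \<Rightarrow> 'w) \<Rightarrow> bool" where
  "algebra_action \<rho> \<longleftrightarrow>
     bilinear \<rho> \<and> (\<forall>w. \<rho> 1 w = w) \<and> (\<forall>a b w. \<rho> (a * b) w = \<rho> a (\<rho> b w))"

text \<open>
  The elements acting as zero form a two-sided ideal, so this ideal contains everything generated by \<open>S\<close>.
\<close>

lemma algebra_action_ideal_cong:
  assumes \<rho>: "algebra_action \<rho>" and S: "\<And>s w. s \<in> S \<Longrightarrow> \<rho> s w = 0"
    and "ideal_cong S a b"
  shows "\<rho> a = \<rho> b"
proof -
  have bil: "bilinear \<rho>"
    using \<rho> by (simp add: algebra_action_def)
  have "two_sided_ideal {a. \<forall>w. \<rho> a w = 0}"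
    using \<rho> by (simp add: two_sided_ideal_def algebra_action_def bilinear_lzero bilinear_rzero
        bilinear_ladd)
  then have "\<forall>w. \<rho> (a - b) w = 0"
    using hull_induct[of "a - b" two_sided_ideal S "\<lambda>a. \<forall>w. \<rho> a w = 0"] assms
    by (auto simp: ideal_cong_def)
  then show ?thesis
    by (simp add: fun_eq_iff bilinear_lsub[OF bil])
qed

text \<open>
  The action of a quotient algebra induced along the projection \<open>\<pi>\<close>, through an arbitrary choice of
  preimages. By \<open>algebra_action_ideal_cong\<close> the choice does not matter if the relations act as zero.
\<close>

definition descend :: "('a \<Rightarrow> 'q) \<Rightarrow> ('a \<Rightarrow> 'w \<Rightarrow> 'w) \<Rightarrow> 'q \<Rightarrow> 'w \<Rightarrow> 'w" where
  "descend \<pi> \<rho> q = \<rho> (inv \<pi> q)"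

lemma descend_action:
  fixes \<pi> :: "'a::real_algebra_1 \<Rightarrow> 'q::real_algebra_1"
  assumes \<rho>: "algebra_action \<rho>" and S: "\<And>s w. s \<in> S \<Longrightarrow> \<rho> s w = 0"
    and \<pi>: "linear \<pi>" "\<pi> 1 = 1" "\<And>a b. \<pi> (a * b) = \<pi> a * \<pi> b" "surj \<pi>"
    and kernel: "\<And>a b. \<pi> a = \<pi> b \<Longrightarrow> ideal_cong S a b"
  shows descend_apply: "descend \<pi> \<rho> (\<pi> a) = \<rho> a"
    and algebra_action_descend: "algebra_action (descend \<pi> \<rho>)"
proof -
  show eq: "descend \<pi> \<rho> (\<pi> a) = \<rho> a" for a
    unfolding descend_def
    by (rule algebra_action_ideal_cong[OF \<rho> S kernel]) (simp_all add: f_inv_into_f)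
  have bil: "bilinear \<rho>" and one: "\<rho> 1 w = w" and mult: "\<rho> (a * b) w = \<rho> a (\<rho> b w)" for a b w
    using \<rho> by (auto simp: algebra_action_def)
  have "bilinear (descend \<pi> \<rho>)"
    unfolding bilinear_def
  proof (intro conjI allI)
    fix q show "linear (descend \<pi> \<rho> q)"
      using bil by (simp add: descend_def bilinear_def)
  next
    fix w
    show "linear (\<lambda>q. descend \<pi> \<rho> q w)"
    proof (rule linearI)
      fix p q :: 'q and c :: real
      obtain a b where [simp]: "p = \<pi> a" "q = \<pi> b"
        using \<pi>(4) by (meson surjD)
      show "descend \<pi> \<rho> (p + q) w = descend \<pi> \<rho> p w + descend \<pi> \<rho> q w"
        using eq[of "a + b"] by (simp add: eq linear_add[OF \<pi>(1)] bilinear_ladd[OF bil])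
      show "descend \<pi> \<rho> (c *\<^sub>R p) w = c *\<^sub>R descend \<pi> \<rho> p w"
        using eq[of "c *\<^sub>R a"] by (simp add: eq linear_scale[OF \<pi>(1)] bilinear_lmul[OF bil])
    qed
  qed
  moreover have "descend \<pi> \<rho> 1 w = w" for w
    using eq[of 1] by (simp add: \<pi>(2) one)
  moreover have "descend \<pi> \<rho> (p * q) w = descend \<pi> \<rho> p (descend \<pi> \<rho> q w)" for p q w
  proof -
    obtain a b where [simp]: "p = \<pi> a" "q = \<pi> b"
      using \<pi>(4) by (meson surjD)
    show ?thesis
      using eq[of "a * b"] by (simp add: eq \<pi>(3) mult)
  qed
  ultimately show "algebra_action (descend \<pi> \<rho>)"
    by (simp add: algebra_action_def)
qed

definition free_act :: "('v \<Rightarrow> 'w::real_vector \<Rightarrow> 'w) \<Rightarrow> ('v list \<Rightarrow>\<^sub>0 real) \<Rightarrow> 'w \<Rightarrow> 'w" where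
  "free_act T p w = lin_ext (\<lambda>vs. foldr T vs w) p"

lemma single_mult_single:
  "Poly_Mapping.single xs (1::real) * Poly_Mapping.single ys 1 = Poly_Mapping.single (xs @ ys) 1"
  by (simp add: mult_single plus_list_def)

lemma algebra_action_free_act:
  assumes T: "\<And>v. linear (T v)"
  shows "algebra_action (free_act T)"
proof -
  have lin_fold: "linear (foldr T vs)" for vs
    by (induction vs) (auto simp: id_def o_def intro: linear_compose[OF _ T, unfolded o_def] linear_ident)
  have "linear (\<lambda>p. free_act T p w)" for w
    unfolding free_act_def by (rule linear_lin_ext)
  moreover have lin2: "linear (free_act T p)" for p
    by (rule linearI) (simp_all add: free_act_def lin_ext_def linear_add[OF lin_fold]
        linear_scale[OF lin_fold] scaleR_right_distrib sum.distrib scaleR_sum_right mult.commute)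
  ultimately have bil: "bilinear (free_act T)"
    by (simp add: bilinear_def)
  have single: "free_act T (Poly_Mapping.single vs 1) w = foldr T vs w" for vs w
    by (simp add: free_act_def)
  have lin_left: "linear (\<lambda>p. free_act T (p * q) w)" and lin_left': "linear (\<lambda>p. free_act T p (free_act T q w))"
    and lin_right: "linear (\<lambda>p. free_act T (q * p) w)" and lin_right': "linear (\<lambda>p. free_act T q (free_act T p w))"
    for q w
    by (rule linearI; simp add: algebra_simps bilinear_ladd[OF bil] bilinear_lmul[OF bil]
          bilinear_radd[OF bil] bilinear_rmul[OF bil])+
  have "free_act T (p * q) w = free_act T p (free_act T q w)" for p q w
  proof (rule linear_eq_on_singles[OF lin_left lin_left'])
    fix vs
    show "free_act T (Poly_Mapping.single vs 1 * q) w = free_act T (Poly_Mapping.single vs 1) (free_act T q w)"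
      by (rule linear_eq_on_singles[OF lin_right lin_right'])
         (simp add: single_mult_single single)
  qed
  moreover have "free_act T 1 w = w" for w
    using single[of "[]" w] by (simp add: single_one[symmetric] zero_list_def)
  ultimately show ?thesis
    using bil by (simp add: algebra_action_def)
qed

definition tensor_act ::
  "('v::real_vector \<Rightarrow> 'w::real_vector \<Rightarrow> 'w) \<Rightarrow> 'v tensor_algebra \<Rightarrow> 'w \<Rightarrow> 'w" where
  "tensor_act T = descend abs_tensor_algebra (free_act T)"

lemma
  assumes T: "bilinear T"
  shows algebra_action_tensor_act: "algebra_action (tensor_act T)"
    and tensor_act_tensor_of: "tensor_act T (tensor_of v) = T v"
proof -
  have lin: "linear (T v)" for v
    using T by (simp add: bilinear_def)
  note act = algebra_action_free_act[of T, OF lin]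
  then have bil: "bilinear (free_act T)"
    by (simp add: algebra_action_def)
  have gen: "free_act T (free_gen v) w = T v w" for v w
    by (simp add: free_act_def free_gen_def)
  have rel: "free_act T s w = 0" if "s \<in> tensor_relations" for s w
    using that by (auto simp: tensor_relations_def gen bilinear_lsub[OF bil] bilinear_ladd[OF bil]
        bilinear_lmul[OF bil] bilinear_ladd[OF T] bilinear_lmul[OF T])
  have quot: "linear (abs_tensor_algebra :: ('a list \<Rightarrow>\<^sub>0 real) \<Rightarrow> _)"
    "abs_tensor_algebra (1 :: 'a list \<Rightarrow>\<^sub>0 real) = 1"
    "abs_tensor_algebra (a * b) = abs_tensor_algebra a * abs_tensor_algebra b"
    "surj (abs_tensor_algebra :: ('a list \<Rightarrow>\<^sub>0 real) \<Rightarrow> _)"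
    "abs_tensor_algebra a = abs_tensor_algebra b \<Longrightarrow> ideal_cong tensor_relations a b"
    for a b :: "'a list \<Rightarrow>\<^sub>0 real"
    using Quotient3_abs_rep[OF Quotient3_tensor_algebra]
    by (auto simp: plus_tensor_algebra.abs_eq scaleR_tensor_algebra.abs_eq one_tensor_algebra.abs_eq
        times_tensor_algebra.abs_eq tensor_algebra.abs_eq_iff intro!: linearI surjI)
  show "algebra_action (tensor_act T)"
    unfolding tensor_act_def by (rule descend_action[OF act rel quot])
  show "tensor_act T (tensor_of v) = T v"
    unfolding tensor_act_def tensor_of_def
    by (rule trans[OF descend_apply[OF act rel quot]]; (assumption | simp add: fun_eq_iff gen))
qed

definition exterior_act ::
  "('v::real_vector \<Rightarrow> 'w::real_vector \<Rightarrow> 'w) \<Rightarrow> 'v exterior_algebra \<Rightarrow> 'w \<Rightarrow> 'w" where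
  "exterior_act T = descend abs_exterior_algebra (tensor_act T)"

lemma
  assumes T: "bilinear T" and square: "\<And>v w. T v (T v w) = 0"
  shows algebra_action_exterior_act: "algebra_action (exterior_act T)"
    and exterior_act_gen: "exterior_act T (abs_exterior_algebra (tensor_of v)) = T v"
proof -
  note act = algebra_action_tensor_act[OF T]
  have rel: "tensor_act T s w = 0" if "s \<in> exterior_relations" for s w
    using that act by (auto simp: exterior_relations_def algebra_action_def tensor_act_tensor_of[OF T] square)
  have quot: "linear (abs_exterior_algebra :: 'a tensor_algebra \<Rightarrow> _)"
    "abs_exterior_algebra (1 :: 'a tensor_algebra) = 1"
    "abs_exterior_algebra (a * b) = abs_exterior_algebra a * abs_exterior_algebra b"
    "surj (abs_exterior_algebra :: 'a tensor_algebra \<Rightarrow> _)"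
    "abs_exterior_algebra a = abs_exterior_algebra b \<Longrightarrow> ideal_cong exterior_relations a b"
    for a b :: "'a tensor_algebra"
    using Quotient3_abs_rep[OF Quotient3_exterior_algebra]
    by (auto simp: plus_exterior_algebra.abs_eq scaleR_exterior_algebra.abs_eq one_exterior_algebra.abs_eq
        times_exterior_algebra.abs_eq exterior_algebra.abs_eq_iff intro!: linearI surjI)
  show "algebra_action (exterior_act T)"
    unfolding exterior_act_def by (rule descend_action[OF act rel quot])
  show "exterior_act T (abs_exterior_algebra (tensor_of v)) = T v"
    unfolding exterior_act_def
    by (rule trans[OF descend_apply[OF act rel quot]]; (assumption | rule tensor_act_tensor_of[OF T]))
qed

definition chain_act ::
  "('v::real_vector multivector \<Rightarrow> 'w::real_vector \<Rightarrow> 'w) \<Rightarrow> 'v chain_algebra \<Rightarrow> 'w \<Rightarrow> 'w" where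
  "chain_act T = descend abs_chain_algebra (tensor_act T)"

lemma
  assumes T: "bilinear T"
    and comm: "\<And>X Y x y w. X \<in> grade_space x \<Longrightarrow> Y \<in> grade_space y \<Longrightarrow>
      T X (T Y w) + (-1) ^ (x * y) *\<^sub>R T Y (T X w) = 0"
  shows algebra_action_chain_act: "algebra_action (chain_act T)"
    and chain_act_gen: "chain_act T (abs_chain_algebra (tensor_of X)) = T X"
proof -
  note act = algebra_action_tensor_act[OF T]
  then have bil: "bilinear (tensor_act T)"
    by (simp add: algebra_action_def)
  have rel: "tensor_act T s w = 0" if "s \<in> chain_relations" for s w
    using that act comm
    by (auto simp: chain_relations_def algebra_action_def tensor_act_tensor_of[OF T]
        bilinear_ladd[OF bil] bilinear_lmul[OF bil])
  have quot: "linear (abs_chain_algebra :: 'a multivector tensor_algebra \<Rightarrow> _)"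
    "abs_chain_algebra (1 :: 'a multivector tensor_algebra) = 1"
    "abs_chain_algebra (a * b) = abs_chain_algebra a * abs_chain_algebra b"
    "surj (abs_chain_algebra :: 'a multivector tensor_algebra \<Rightarrow> _)"
    "abs_chain_algebra a = abs_chain_algebra b \<Longrightarrow> ideal_cong chain_relations a b"
    for a b :: "'a multivector tensor_algebra"
    using Quotient3_abs_rep[OF Quotient3_chain_algebra]
    by (auto simp: plus_chain_algebra.abs_eq scaleR_chain_algebra.abs_eq one_chain_algebra.abs_eq
        times_chain_algebra.abs_eq chain_algebra.abs_eq_iff intro!: linearI surjI)
  show "algebra_action (chain_act T)"
    unfolding chain_act_def by (rule descend_action[OF act rel quot])
  show "chain_act T (abs_chain_algebra (tensor_of X)) = T X"
    unfolding chain_act_def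
    by (rule trans[OF descend_apply[OF act rel quot]]; (assumption | rule tensor_act_tensor_of[OF T]))
qed

section \<open>Spanning sets of the algebras\<close>

lemma linear_tensor_of: "linear tensor_of"
proof (rule linearI)
  show "tensor_of (u + v) = tensor_of u + tensor_of v" for u v :: 'a
    unfolding tensor_of_def plus_tensor_algebra.abs_eq tensor_algebra.abs_eq_iff ideal_cong_def
    by (rule hull_inc) (auto simp: tensor_relations_def)
  show "tensor_of (c *\<^sub>R v) = c *\<^sub>R tensor_of v" for c and v :: 'a
    unfolding tensor_of_def scaleR_tensor_algebra.abs_eq tensor_algebra.abs_eq_iff ideal_cong_def
    by (rule hull_inc) (auto simp: tensor_relations_def)
qed

lemma linear_abs_exterior: "linear abs_exterior_algebra"
  by (rule linearI) (simp_all add: plus_exterior_algebra.abs_eq scaleR_exterior_algebra.abs_eq)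

lemma linear_abs_chain: "linear abs_chain_algebra"
  by (rule linearI) (simp_all add: plus_chain_algebra.abs_eq scaleR_chain_algebra.abs_eq)

lemma prod_list_tensor_of:
  "prod_list (map tensor_of vs) = abs_tensor_algebra (Poly_Mapping.single vs 1)"
proof (induction vs)
  case Nil
  then show ?case
    by (simp add: one_tensor_algebra.abs_eq single_one[symmetric] zero_list_def)
next
  case (Cons v vs)
  then show ?case
    by (simp add: tensor_of_def free_gen_def times_tensor_algebra.abs_eq single_mult_single)
qed

lemma span_prod_list_tensor_of: "span (range (\<lambda>vs. prod_list (map tensor_of vs))) = UNIV"
proof -
  have lin: "linear (abs_tensor_algebra :: ('a list \<Rightarrow>\<^sub>0 real) \<Rightarrow> _)"
    by (rule linearI) (simp_all add: plus_tensor_algebra.abs_eq scaleR_tensor_algebra.abs_eq)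
  have "t \<in> span (range (\<lambda>vs. prod_list (map tensor_of vs)))" for t :: "'a tensor_algebra"
  proof -
    obtain p where t: "t = abs_tensor_algebra p"
      by (metis Quotient3_abs_rep[OF Quotient3_tensor_algebra])
    have "abs_tensor_algebra p = (\<Sum>k\<in>Poly_Mapping.keys p.
        Poly_Mapping.lookup p k *\<^sub>R prod_list (map tensor_of k))"
      by (subst (1) poly_mapping_eq_sum_single)
         (simp add: linear_sum[OF lin] linear_scale[OF lin] prod_list_tensor_of)
    then show ?thesis
      unfolding t by (simp only:) (intro span_sum span_scale span_base rangeI)
  qed
  then show ?thesis by blast
qed

lemma chain_prod_eq: "chain_prod Ys = abs_chain_algebra (prod_list (map tensor_of Ys))"
  by (induction Ys) (simp_all add: chain_prod_def one_chain_algebra.abs_eq times_chain_algebra.abs_eq)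

lemma wedge_eq: "wedge vs = abs_exterior_algebra (prod_list (map tensor_of vs))"
  by (induction vs) (simp_all add: wedge_def one_exterior_algebra.abs_eq times_exterior_algebra.abs_eq)

lemma span_chain_prod: "span (range chain_prod) = UNIV"
proof -
  have *: "range chain_prod = abs_chain_algebra ` range (\<lambda>Ys. prod_list (map tensor_of Ys))"
    by (auto simp: chain_prod_eq)
  have "span (range (chain_prod :: 'a multivector list \<Rightarrow> _)) = range abs_chain_algebra"
    unfolding * linear_span_image[OF linear_abs_chain] span_prod_list_tensor_of ..
  also have "\<dots> = UNIV"
    using Quotient3_abs_rep[OF Quotient3_chain_algebra] by (auto intro!: surjI)
  finally show ?thesis .
qed

lemma exterior_power_eq: "exterior_power k = span {wedge vs | vs. length vs = k}"
proof -
  have *: "{wedge vs | vs. length vs = k} =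
      abs_exterior_algebra ` {prod_list (map tensor_of vs) | vs. length vs = k}"
    by (auto simp: wedge_eq)
  show ?thesis
    unfolding * exterior_power_def tensor_power_def linear_span_image[OF linear_abs_exterior] ..
qed


section \<open>The model of the chain complex\<close>

type_synonym model = "(bool \<times> bool \<times> nat) \<Rightarrow>\<^sub>0 real"

abbreviation mon :: "bool \<Rightarrow> bool \<Rightarrow> nat \<Rightarrow> model" where
  "mon a b k \<equiv> Poly_Mapping.single (a, b, k) 1"

text \<open>
  With \<open>mon a b k\<close> standing for \<open>e\<^sup>a f\<^sup>b u\<^sup>k\<close>, these are the multiplications
  from the left by \<open>e\<close>, \<open>f\<close> and \<open>u\<close>; the signs come from moving the new factor past
  \<open>e\<close> and \<open>f\<close>.
\<close>

definition mult_e :: "model \<Rightarrow> model" where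
  "mult_e = lin_ext (\<lambda>(a, b, k). if a then 0 else mon True b k)"

definition mult_f :: "model \<Rightarrow> model" where
  "mult_f = lin_ext (\<lambda>(a, b, k). if b then 0 else (if a then -1 else 1) *\<^sub>R mon a True k)"

definition mult_u :: "model \<Rightarrow> model" where
  "mult_u = lin_ext (\<lambda>(a, b, k). (if a = b then 1 else -1) *\<^sub>R mon a b (Suc k))"

text \<open>
  These maps are the boundary operator and the superderivations that extend the brackets with
  \<open>e\<close>, \<open>f\<close> and \<open>u\<close>. The derivation \<open>ad_u\<close> is odd: it picks up a sign when it passes \<open>u\<close>, but
  none when it passes \<open>e\<close> or \<open>f\<close>.
\<close>

definition model_boundary :: "model \<Rightarrow> model" where
  "model_boundary = lin_ext (\<lambda>(a, b, k). if a then (of_bool b + real k) *\<^sub>R mon False b k else 0)"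

definition ad_e :: "model \<Rightarrow> model" where
  "ad_e = lin_ext (\<lambda>(a, b, k). (of_bool b + real k) *\<^sub>R mon a b k)"

definition ad_f :: "model \<Rightarrow> model" where
  "ad_f = lin_ext (\<lambda>(a, b, k). if a \<and> \<not> b then - mon False True k else 0)"

definition ad_u :: "model \<Rightarrow> model" where
  "ad_u = lin_ext (\<lambda>(a, b, k). if a then (if b then 1 else -1) *\<^sub>R mon False b (Suc k) else 0)"

lemma linear_model_maps: "linear mult_e" "linear mult_f" "linear mult_u" "linear model_boundary" "linear ad_e" "linear ad_f" "linear ad_u"
  by (simp_all add: mult_e_def mult_f_def mult_u_def model_boundary_def ad_e_def ad_f_def ad_u_def linear_lin_ext)

lemmas model_linearity [simp] =
  linear_model_maps[THEN linear_add] linear_model_maps[THEN linear_scale] linear_model_maps[THEN linear_0]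
  linear_model_maps[THEN linear_neg] linear_model_maps[THEN linear_diff]

lemma model_maps_mon [simp]:
  "mult_e (mon a b k) = (if a then 0 else mon True b k)"
  "mult_f (mon a b k) = (if b then 0 else (if a then -1 else 1) *\<^sub>R mon a True k)"
  "mult_u (mon a b k) = (if a = b then 1 else -1) *\<^sub>R mon a b (Suc k)"
  "model_boundary (mon a b k) = (if a then (of_bool b + real k) *\<^sub>R mon False b k else 0)"
  "ad_e (mon a b k) = (of_bool b + real k) *\<^sub>R mon a b k"
  "ad_f (mon a b k) = (if a \<and> \<not> b then - mon False True k else 0)"
  "ad_u (mon a b k) = (if a then (if b then 1 else -1) *\<^sub>R mon False b (Suc k) else 0)"
  by (simp_all add: mult_e_def mult_f_def mult_u_def model_boundary_def ad_e_def ad_f_def ad_u_def)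

text \<open>
  All properties checked on the model are linear in \<open>w\<close>. The four kinds of basis elements are separate cases
  because the signs and factors in the operators depend on \<open>a\<close> and \<open>b\<close>.
\<close>

lemma model_induct [case_names add scaleR one E F EF]:
  assumes add: "\<And>v w. P v \<Longrightarrow> P w \<Longrightarrow> P (v + w)" and scaleR: "\<And>c w. P w \<Longrightarrow> P (c *\<^sub>R w)"
    and one: "\<And>k. P (mon False False k)" and E: "\<And>k. P (mon True False k)"
    and F: "\<And>k. P (mon False True k)" and EF: "\<And>k. P (mon True True k)"
  shows "P (w :: model)"
proof -
  have mon: "P (mon a b k)" for a b k
    by (cases a; cases b; simp add: one E F EF)
  have "P 0"
    using scaleR[OF mon, of 0] by simp
  then have "P (\<Sum>i\<in>A. Poly_Mapping.lookup w i *\<^sub>R Poly_Mapping.single i 1)" for A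
    by (induction A rule: infinite_finite_induct) (use add scaleR mon in auto)
  then show ?thesis
    using poly_mapping_eq_sum_single[of w] by metis
qed

lemma mult_relations:
  "mult_e (mult_e w) = 0" "mult_f (mult_f w) = 0" "mult_f (mult_e w) = - mult_e (mult_f w)"
  "mult_u (mult_e w) = - mult_e (mult_u w)" "mult_u (mult_f w) = - mult_f (mult_u w)"
  by (induction w rule: model_induct; simp)+

text \<open>
  The recursion for the boundary of a product with one more factor in front. Together with
  \<open>ad_mult\<close> it determines \<open>model_boundary\<close> from its value on \<open>1\<close>.
\<close>

lemma model_boundary_mult:
  "model_boundary (mult_e w) = ad_e w - mult_e (model_boundary w)"
  "model_boundary (mult_f w) = ad_f w - mult_f (model_boundary w)"
  "model_boundary (mult_u w) = ad_u w - mult_u (model_boundary w)"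
  by (induction w rule: model_induct;
      ((simp add: algebra_simps; fail) | (simp add: scaleR_right_distrib scaleR_right_diff_distrib; fail)
        | (rule poly_mapping_eqI, simp add: lookup_add lookup_minus algebra_simps; fail)))+

lemma ad_mult:
  "ad_e (mult_e w) = mult_e (ad_e w)"
  "ad_e (mult_f w) = mult_f w + mult_f (ad_e w)"
  "ad_e (mult_u w) = mult_u w + mult_u (ad_e w)"
  "ad_f (mult_e w) = mult_e (ad_f w) - mult_f w"
  "ad_f (mult_f w) = mult_f (ad_f w)"
  "ad_f (mult_u w) = mult_u (ad_f w)"
  "ad_u (mult_e w) = mult_e (ad_u w) - mult_u w"
  "ad_u (mult_f w) = mult_f (ad_u w)"
  "ad_u (mult_u w) = - mult_u (ad_u w)"
  by (induction w rule: model_induct;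
      ((simp add: algebra_simps; fail) | (simp add: scaleR_right_distrib scaleR_right_diff_distrib; fail)
        | (rule poly_mapping_eqI, simp add: lookup_add lookup_minus algebra_simps; fail)))+


section \<open>Multivectors of the nonabelian plane\<close>

lemma wedge_Nil: "wedge [] = 1"
  and wedge_Cons: "wedge (v # vs) = abs_exterior_algebra (tensor_of v) * wedge vs"
  by (simp_all add: wedge_def)

lemma ext_square: "abs_exterior_algebra (tensor_of v) * abs_exterior_algebra (tensor_of v) = 0"
  unfolding times_exterior_algebra.abs_eq[symmetric] zero_exterior_algebra_def
  by (simp add: times_exterior_algebra.abs_eq exterior_algebra.abs_eq_iff ideal_cong_def)
    (rule hull_inc, auto simp: exterior_relations_def)

lemma length_omit: "i < length xs \<Longrightarrow> length (omit i xs) = length xs - 1"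
  by (simp add: omit_def)

locale nonabelian_plane = real_lie_algebra br for br :: "'g::real_vector \<Rightarrow> 'g \<Rightarrow> 'g" +
  fixes e f :: 'g and xi eta :: "'g \<Rightarrow> real"
  assumes linear_xi: "linear xi" and linear_eta: "linear eta"
    and expand: "v = xi v *\<^sub>R e + eta v *\<^sub>R f"
    and dual [simp]: "xi e = 1" "xi f = 0" "eta e = 0" "eta f = 1"
    and bracket_ef: "br e f = f"
    and dim_plane: "dim (UNIV :: 'g set) = 2"
begin

lemmas coord_linearity [simp] =
  linear_xi[THEN linear_add] linear_xi[THEN linear_scale] linear_eta[THEN linear_add] linear_eta[THEN linear_scale]

text \<open>
  The determinant in the basis \<open>e, f\<close>; the bracket and the wedge product of two vectors are both multiples of it.
\<close>

definition area :: "'g \<Rightarrow> 'g \<Rightarrow> real" where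
  "area v w = xi v * eta w - eta v * xi w"

lemma br_eq: "br v w = area v w *\<^sub>R f"
proof -
  note bil = bilinear_ladd[OF bilinear_br] bilinear_radd[OF bilinear_br]
    bilinear_lmul[OF bilinear_br] bilinear_rmul[OF bilinear_br]
  have "br (e + f) (e + f) = br e e + br e f + (br f e + br f f)"
    by (simp only: bil add_ac)
  then have "f + br f e = 0"
    by (simp add: alternating bracket_ef)
  then have "br f e = - f"
    by (simp add: add_eq_0_iff)
  then have "br (xi v *\<^sub>R e + eta v *\<^sub>R f) (xi w *\<^sub>R e + eta w *\<^sub>R f) = area v w *\<^sub>R f"
    by (simp add: bil alternating bracket_ef area_def algebra_simps)
  then show ?thesis
    by (simp only: expand[symmetric])
qed

lemma area_br: "area (br v p) q = - (area v p * xi q)"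
  by (simp add: br_eq area_def[of "_ *\<^sub>R f"])

abbreviation ext :: "'g \<Rightarrow> 'g exterior_algebra" where
  "ext v \<equiv> abs_exterior_algebra (tensor_of v)"

definition ext_ef :: "'g exterior_algebra" where
  "ext_ef = ext e * ext f"

lemma linear_ext: "linear ext"
  using linear_compose[OF linear_tensor_of linear_abs_exterior] by (simp add: o_def)

lemma ext_expand: "ext v = xi v *\<^sub>R ext e + eta v *\<^sub>R ext f"
  by (subst expand) (simp only: linear_add[OF linear_ext] linear_scale[OF linear_ext])

lemma ext_fe: "ext f * ext e = - ext_ef"
  using ext_square[of "e + f"]
  by (simp add: linear_add[OF linear_ext] algebra_simps ext_square eq_neg_iff_add_eq_0 ext_ef_def)

lemma ext_mult: "ext v * ext w = area v w *\<^sub>R ext_ef"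
  by (subst (1 2) ext_expand) (simp add: algebra_simps ext_square ext_fe area_def ext_ef_def[symmetric])

lemma ext_mult3: "ext v * ext_ef = 0"
proof -
  have "ext e * ext_ef = 0"
    by (simp add: ext_ef_def mult.assoc[symmetric] ext_square)
  moreover have "ext f * ext_ef = 0"
    by (simp add: ext_ef_def mult.assoc[symmetric] ext_fe) (simp add: ext_ef_def mult.assoc ext_square)
  ultimately show ?thesis
    by (subst ext_expand) (simp add: distrib_right)
qed

text \<open>
  With three factors one of \<open>e\<close> and \<open>f\<close> must occur twice.
\<close>

lemma wedge_long:
  fixes vs :: "'g list"
  assumes "length vs \<ge> 3"
  shows "wedge vs = 0"
proof -
  obtain v w z zs where "vs = v # w # z # zs"
    using assms by (auto simp: numeral_3_eq_3 Suc_le_length_iff)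
  moreover have "ext v * (ext w * (ext z * x)) = 0" for x
    by (metis ext_mult ext_mult3 mult.assoc mult_scaleR_right mult_zero_left scaleR_zero_right)
  ultimately show ?thesis
    by (simp add: wedge_Cons)
qed

text \<open>
  Wedging with a vector, on the part of the model without \<open>u\<close>. Since \<open>ext_op v\<close> squares to zero, the
  exterior algebra acts.
\<close>

definition ext_op :: "'g \<Rightarrow> model \<Rightarrow> model" where
  "ext_op v w = xi v *\<^sub>R mult_e w + eta v *\<^sub>R mult_f w"

lemma bilinear_ext_op: "bilinear ext_op"
  unfolding bilinear_def by (intro conjI allI linearI) (simp_all add: ext_op_def algebra_simps)

lemma ext_op_square: "ext_op v (ext_op v w) = 0"
  by (simp add: ext_op_def algebra_simps mult_relations)

lemmas ext_act = algebra_action_exterior_act[OF bilinear_ext_op ext_op_square]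
  exterior_act_gen[OF bilinear_ext_op ext_op_square]

text \<open>
  The coordinates of the result of applying \<open>x\<close> to the symbol \<open>1\<close>. They separate
  \<open>e\<close>, \<open>f\<close> and \<open>e \<and> f\<close>, hence show that these are independent.
\<close>

definition ext_coord :: "bool \<Rightarrow> bool \<Rightarrow> 'g exterior_algebra \<Rightarrow> real" where
  "ext_coord a b x = Poly_Mapping.lookup (exterior_act ext_op x (mon False False 0)) (a, b, 0)"

lemma linear_ext_coord: "linear (ext_coord a b)"
proof -
  have "bilinear (exterior_act ext_op)"
    using ext_act(1) by (simp add: algebra_action_def)
  then show ?thesis
    by (intro linearI) (simp_all add: ext_coord_def bilinear_ladd bilinear_lmul lookup_add)
qed

lemma ext_coord_ext:
  "ext_coord a b (ext v) = (if a \<and> \<not> b then xi v else if \<not> a \<and> b then eta v else 0)"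
  by (simp add: ext_coord_def ext_act(2) ext_op_def lookup_add lookup_single)

lemma ext_coord_ef: "ext_coord a b ext_ef = (if a \<and> b then 1 else 0)"
proof -
  have "exterior_act ext_op ext_ef w = ext_op e (ext_op f w)" for w
    using ext_act by (simp add: algebra_action_def ext_ef_def)
  then show ?thesis
    by (simp add: ext_coord_def ext_op_def lookup_single)
qed

lemma exterior_power_cases:
  assumes "x \<in> exterior_power (Suc i)"
  shows "i = 0 \<and> (\<exists>v. x = ext v) \<or> i = 1 \<and> (\<exists>c. x = c *\<^sub>R ext_ef) \<or> x = 0"
proof -
  have x: "x \<in> span {wedge vs | vs. length vs = Suc i}"
    using assms by (simp add: exterior_power_eq)
  consider "i = 0" | "i = 1" | "i \<ge> 2"
    by linarith
  then show ?thesis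
  proof cases
    case 1
    have "span {wedge vs | vs. length vs = Suc i} \<subseteq> range ext"
    proof (rule span_minimal)
      show "{wedge vs | vs. length vs = Suc i} \<subseteq> range ext"
        using 1 by (auto simp: length_Suc_conv wedge_Cons wedge_Nil)
      show "subspace (range ext)"
        by (intro linear_subspace_image[OF linear_ext] subspace_UNIV)
    qed
    then show ?thesis
      using x 1 by auto
  next
    case 2
    have "{wedge vs | vs. length vs = Suc i} \<subseteq> span {ext_ef}"
      using 2 by (auto simp: length_Suc_conv wedge_Cons wedge_Nil ext_mult span_singleton)
    then have "span {wedge vs | vs. length vs = Suc i} \<subseteq> span {ext_ef}"
      by (intro span_minimal subspace_span)
    then show ?thesis
      using x 2 by (auto simp: span_singleton)
  next
    case 3
    have "{wedge vs | vs :: 'g list. length vs = Suc i} \<subseteq> {0}"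
      using 3 by (auto intro!: wedge_long)
    then have "span {wedge vs | vs :: 'g list. length vs = Suc i} \<subseteq> {0}"
      by (intro span_minimal) (auto simp: subspace_def)
    then show ?thesis
      using x by auto
  qed
qed

lemma ext_power_mem: "ext v \<in> exterior_power (Suc 0)" "ext_ef \<in> exterior_power (Suc 1)"
  unfolding exterior_power_eq
  by (rule span_base, force simp: length_Suc_conv wedge_Cons wedge_Nil ext_ef_def)+

lemma ext_coord_expand:
  assumes "x \<in> span (\<Union>i<dim (UNIV :: 'g set). exterior_power (Suc i))"
  shows "x = ext_coord True False x *\<^sub>R ext e + ext_coord False True x *\<^sub>R ext f +
    ext_coord True True x *\<^sub>R ext_ef" (is "_ = ?P x")
proof (rule linear_eq_on_span[OF _ _ _ assms, of "\<lambda>x. x" ?P])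
  show "linear (\<lambda>x :: 'g exterior_algebra. x)"
    by (rule linear_ident)
  show "linear ?P"
    by (intro linearI) (simp_all add: linear_add[OF linear_ext_coord] linear_scale[OF linear_ext_coord]
        algebra_simps)
  fix x :: "'g exterior_algebra"
  assume "x \<in> (\<Union>i<dim (UNIV :: 'g set). exterior_power (Suc i))"
  then obtain i where "x \<in> exterior_power (Suc i)"
    by blast
  from exterior_power_cases[OF this] show "x = ?P x"
    by (auto simp: ext_coord_ext ext_coord_ef linear_scale[OF linear_ext_coord]
        linear_0[OF linear_ext_coord] ext_expand[symmetric])
qed

abbreviation cE :: "'g multivector \<Rightarrow> real" where "cE X \<equiv> ext_coord True False (Rep_multivector X)"
abbreviation cF :: "'g multivector \<Rightarrow> real" where "cF X \<equiv> ext_coord False True (Rep_multivector X)"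
abbreviation cU :: "'g multivector \<Rightarrow> real" where "cU X \<equiv> ext_coord True True (Rep_multivector X)"

definition mE :: "'g multivector" where "mE = Abs_multivector (ext e)"
definition mF :: "'g multivector" where "mF = Abs_multivector (ext f)"
definition mU :: "'g multivector" where "mU = Abs_multivector ext_ef"

lemma Rep_basis [simp]:
  "Rep_multivector mE = ext e" "Rep_multivector mF = ext f" "Rep_multivector mU = ext_ef"
  unfolding mE_def mF_def mU_def dim_plane
  by (rule Abs_multivector_inverse, unfold dim_plane, rule span_base,
      insert ext_power_mem, force simp: lessThan_Suc numeral_2_eq_2)+

lemma linear_Rep: "linear Rep_multivector"
  by (rule linearI) (transfer, simp)+

lemma linear_coords: "linear cE" "linear cF" "linear cU"
  using linear_compose[OF linear_Rep linear_ext_coord] by (simp_all add: o_def)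

lemmas multivector_coord_linearity [simp] =
  linear_coords[THEN linear_add] linear_coords[THEN linear_scale] linear_coords[THEN linear_0]

lemma multivector_expand: "X = cE X *\<^sub>R mE + cF X *\<^sub>R mF + cU X *\<^sub>R mU"
proof -
  have "Rep_multivector X \<in> span (\<Union>i<dim (UNIV :: 'g set). exterior_power (Suc i))"
    by (rule Rep_multivector)
  from ext_coord_expand[OF this] show ?thesis
    by (simp add: Rep_multivector_inject[symmetric] linear_add[OF linear_Rep] linear_scale[OF linear_Rep])
qed

lemma grade_space_cases:
  assumes "X \<in> grade_space i"
  shows "i = 0 \<and> cU X = 0 \<or> i = 1 \<and> cE X = 0 \<and> cF X = 0 \<or> X = 0"
  using exterior_power_cases[of "Rep_multivector X" i] assms
  by (auto simp: grade_space_def ext_coord_ext ext_coord_ef linear_scale[OF linear_ext_coord]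
      Rep_multivector_inject[symmetric] linear_0[OF linear_Rep])

lemma basis_grades: "mE \<in> grade_space 0" "mF \<in> grade_space 0" "mU \<in> grade_space 1"
  using ext_power_mem by (simp_all add: grade_space_def)

text \<open>
  The value of the Schouten bracket on the basis: \<open>[e, f] = f\<close>, \<open>[e, u] = u\<close> and
  \<open>[f, u] = [u, u] = 0\<close>, extended by \<open>[X, Y] = - [Y, X]\<close>. This antisymmetry has no further sign because the only pair of odd elements, \<open>u\<close> with itself, has bracket \<open>0\<close>.
\<close>

definition bracket :: "'g multivector \<Rightarrow> 'g multivector \<Rightarrow> 'g multivector" where
  "bracket X Y = (cE X * cF Y - cF X * cE Y) *\<^sub>R mF + (cE X * cU Y - cU X * cE Y) *\<^sub>R mU"

lemma bilinear_bracket: "bilinear bracket"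
  unfolding bilinear_def by (intro conjI allI linearI) (simp_all add: bracket_def algebra_simps)

lemma Rep_bracket: "Rep_multivector (bracket X Y) =
    (cE X * cF Y - cF X * cE Y) *\<^sub>R ext f + (cE X * cU Y - cU X * cE Y) *\<^sub>R ext_ef"
  by (simp add: bracket_def linear_add[OF linear_Rep] linear_scale[OF linear_Rep])

lemma coords_wedge:
  "Rep_multivector X = wedge [v] \<Longrightarrow> cE X = xi v \<and> cF X = eta v \<and> cU X = 0"
  "Rep_multivector X = wedge [v, w] \<Longrightarrow> cE X = 0 \<and> cF X = 0 \<and> cU X = area v w"
  by (simp_all add: wedge_Cons[of _ "[]"] wedge_Cons[of _ "[_]"] wedge_Nil wedge_long ext_mult
      ext_coord_ext ext_coord_ef linear_scale[OF linear_ext_coord] linear_0[OF linear_ext_coord])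

text \<open>
  The terms on the right are wedges of \<open>length as + length bs - 1\<close> vectors, so they vanish unless one of
  the lists has length 1 and the other at most 2. In the vanishing case, a list of length at least 2 has a
  wedge without grade 0 part, and one of length at least 3 has wedge \<open>0\<close>, which makes the left side vanish too.
\<close>

lemma bracket_wedge:
  assumes ne: "as \<noteq> []" "bs \<noteq> []" and X: "Rep_multivector X = wedge as" and Y: "Rep_multivector Y = wedge bs"
  shows "Rep_multivector (bracket X Y) =
    (\<Sum>i<length as. \<Sum>j<length bs.
       (-1) ^ (i + j) *\<^sub>R wedge (br (as ! i) (bs ! j) # omit i as @ omit j bs))"
proof (cases "length as + length bs \<le> 3")
  case True
  then consider v w where "as = [v]" "bs = [w]" | v p q where "as = [v]" "bs = [p, q]"
    | p q w where "as = [p, q]" "bs = [w]"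
    using ne by (cases as; cases bs; cases "tl as"; cases "tl bs") auto
  then show ?thesis
  proof cases
    case 1
    then have "cE X = xi v" "cF X = eta v" "cU X = 0" "cE Y = xi w" "cF Y = eta w" "cU Y = 0"
      using coords_wedge(1) X Y by auto
    then show ?thesis
      using 1 by (simp add: Rep_bracket omit_def wedge_Cons wedge_Nil br_eq linear_scale[OF linear_ext] area_def)
  next
    case 2
    then have "cE X = xi v" "cF X = eta v" "cU X = 0" "cE Y = 0" "cF Y = 0" "cU Y = area p q"
      using coords_wedge X Y by auto
    moreover have "xi v * area p q = area (br v p) q - area (br v q) p"
      unfolding area_br by (simp add: area_def algebra_simps)
    ultimately show ?thesis
      using 2 by (simp add: Rep_bracket omit_def wedge_Cons wedge_Nil ext_mult numeral_2_eq_2 scaleR_diff_left)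
  next
    case 3
    then have "cE X = 0" "cF X = 0" "cU X = area p q" "cE Y = xi w" "cF Y = eta w" "cU Y = 0"
      using coords_wedge X Y by auto
    moreover have "- area p q * xi w = area (br p w) q - area (br q w) p"
      unfolding area_br by (simp add: area_def algebra_simps)
    ultimately show ?thesis
      using 3 by (simp add: Rep_bracket omit_def wedge_Cons wedge_Nil ext_mult numeral_2_eq_2 scaleR_diff_left)
  qed
next
  case False
  have "wedge (br (as ! i) (bs ! j) # omit i as @ omit j bs) = 0" if "i < length as" "j < length bs" for i j
    using that False by (intro wedge_long) (simp add: length_omit)
  then have rhs: "(\<Sum>i<length as. \<Sum>j<length bs.
       (-1) ^ (i + j) *\<^sub>R wedge (br (as ! i) (bs ! j) # omit i as @ omit j bs)) = 0"
    by simp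
  \<comment> \<open>If both lists have length 2, both multivectors are multiples of u, whose bracket with itself is zero.\<close>
  have two: "cE Z = 0 \<and> cF Z = 0" if "Rep_multivector Z = wedge cs" "length cs = 2" for Z cs
    using that coords_wedge(2)[of Z] by (auto simp: length_Suc_conv numeral_2_eq_2)
  have three: "cE Z = 0 \<and> cF Z = 0 \<and> cU Z = 0" if "Rep_multivector Z = wedge cs" "length cs \<ge> 3" for Z cs
    using that wedge_long[of cs] by (simp add: linear_0[OF linear_ext_coord])
  \<comment> \<open>The lengths add up to at least 4 here.\<close>
  consider "length as \<ge> 3" | "length bs \<ge> 3" | "length as = 2" "length bs = 2"
  proof -
    have "length as \<ge> 1" "length bs \<ge> 1"
      using ne by (simp_all add: Suc_le_eq)
    then have "length as \<ge> 3 \<or> length bs \<ge> 3 \<or> length as = 2 \<and> length bs = 2"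
      using False by linarith
    then show thesis
      using that by blast
  qed
  then have "bracket X Y = 0"
  proof cases
    case 1
    with three X show ?thesis by (simp add: bracket_def)
  next
    case 2
    with three Y show ?thesis by (simp add: bracket_def)
  next
    case 3
    with two X Y show ?thesis by (simp add: bracket_def)
  qed
  then show ?thesis
    by (simp add: rhs linear_0[OF linear_Rep])
qed

text \<open>
  Uniqueness comes for free: \<open>e\<close>, \<open>f\<close> and \<open>u\<close> are wedges, so the defining formula forces any
  other candidate to agree with \<open>bracket\<close> on a basis.
\<close>

lemma schouten_eq: "schouten br = bracket"
  unfolding schouten_def
proof (rule the_equality, intro conjI allI impI)
  show "bilinear bracket"
    by (rule bilinear_bracket)
next
  fix X Y :: "'g multivector" and as bs :: "'g list"
  assume "as \<noteq> []" "bs \<noteq> []" "Rep_multivector X = wedge as" "Rep_multivector Y = wedge bs"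
  then show "Rep_multivector (bracket X Y) =
    (\<Sum>i<length as. \<Sum>j<length bs.
       (-1) ^ (i + j) *\<^sub>R wedge (br (as ! i) (bs ! j) # omit i as @ omit j bs))"
    by (rule bracket_wedge)
next
  fix B :: "'g multivector \<Rightarrow> 'g multivector \<Rightarrow> 'g multivector"
  assume B: "bilinear B \<and> (\<forall>X Y as bs. as \<noteq> [] \<longrightarrow> bs \<noteq> [] \<longrightarrow>
        Rep_multivector X = wedge as \<longrightarrow> Rep_multivector Y = wedge bs \<longrightarrow>
        Rep_multivector (B X Y) =
          (\<Sum>i<length as. \<Sum>j<length bs.
             (-1) ^ (i + j) *\<^sub>R wedge (br (as ! i) (bs ! j) # omit i as @ omit j bs)))"
  have decomposable: "\<exists>vs. vs \<noteq> [] \<and> Rep_multivector Z = wedge vs" if "Z \<in> {mE, mF, mU}" for Z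
  proof -
    have "Rep_multivector mE = wedge [e]" "Rep_multivector mF = wedge [f]" "Rep_multivector mU = wedge [e, f]"
      by (simp_all add: wedge_Cons wedge_Nil ext_ef_def)
    with that show ?thesis by blast
  qed
  have eq: "B X Y = bracket X Y" if XY: "X \<in> {mE, mF, mU}" "Y \<in> {mE, mF, mU}" for X Y
  proof -
    obtain as bs where "as \<noteq> []" "bs \<noteq> []" "Rep_multivector X = wedge as" "Rep_multivector Y = wedge bs"
      using decomposable XY by meson
    then have "Rep_multivector (B X Y) = Rep_multivector (bracket X Y)"
      using B bracket_wedge[of as bs X Y] by simp
    then show ?thesis
      by (simp add: Rep_multivector_inject)
  qed
  have "B X Y = bracket X Y" for X Y
  proof -
    have expansion: "C X Y = C (cE X *\<^sub>R mE + cF X *\<^sub>R mF + cU X *\<^sub>R mU) (cE Y *\<^sub>R mE + cF Y *\<^sub>R mF + cU Y *\<^sub>R mU)"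
      for C :: "'g multivector \<Rightarrow> 'g multivector \<Rightarrow> 'g multivector"
      by (simp only: multivector_expand[symmetric])
    have bilB: "bilinear B"
      using B by blast
    show ?thesis
      unfolding expansion[of B] expansion[of bracket]
      by (simp add: bilinear_ladd[OF bilB] bilinear_radd[OF bilB] bilinear_lmul[OF bilB] bilinear_rmul[OF bilB]
          bilinear_ladd[OF bilinear_bracket] bilinear_radd[OF bilinear_bracket]
          bilinear_lmul[OF bilinear_bracket] bilinear_rmul[OF bilinear_bracket] eq)
  qed
  then show "B = bracket"
    by (simp add: fun_eq_iff)
qed

end


section \<open>The chain algebra\<close>

lemma chain_prod_Nil: "chain_prod [] = 1"
  and chain_prod_Cons: "chain_prod (Y # Ys) = abs_chain_algebra (tensor_of Y) * chain_prod Ys"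
  by (simp_all add: chain_prod_def)

lemma chain_commute:
  assumes "X \<in> grade_space x" "Y \<in> grade_space y"
  shows "abs_chain_algebra (tensor_of X) * abs_chain_algebra (tensor_of Y) =
    - ((-1) ^ (x * y) *\<^sub>R (abs_chain_algebra (tensor_of Y) * abs_chain_algebra (tensor_of X)))"
proof -
  have "ideal_cong chain_relations
      (tensor_of X * tensor_of Y + (-1) ^ (x * y) *\<^sub>R (tensor_of Y * tensor_of X)) 0"
    unfolding ideal_cong_def diff_zero
    by (rule hull_inc) (use assms in \<open>auto simp: chain_relations_def\<close>)
  then have "abs_chain_algebra (tensor_of X) * abs_chain_algebra (tensor_of Y) +
      (-1) ^ (x * y) *\<^sub>R (abs_chain_algebra (tensor_of Y) * abs_chain_algebra (tensor_of X)) = 0"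
    by (simp add: chain_algebra.abs_eq_iff[symmetric] plus_chain_algebra.abs_eq[symmetric]
        times_chain_algebra.abs_eq[symmetric] scaleR_chain_algebra.abs_eq[symmetric]
        zero_chain_algebra_def[symmetric])
  then show ?thesis
    by (simp add: eq_neg_iff_add_eq_0)
qed

context nonabelian_plane
begin

abbreviation ch :: "'g multivector \<Rightarrow> 'g chain_algebra" where
  "ch X \<equiv> abs_chain_algebra (tensor_of X)"

lemma linear_ch: "linear ch"
  using linear_compose[OF linear_tensor_of linear_abs_chain] by (simp add: o_def)

lemma ch_expand: "ch X = cE X *\<^sub>R ch mE + cF X *\<^sub>R ch mF + cU X *\<^sub>R ch mU"
  by (subst multivector_expand) (simp only: linear_add[OF linear_ch] linear_scale[OF linear_ch])

lemma ch_relations: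
  "ch mE * ch mE = 0" "ch mF * ch mF = 0" "ch mF * ch mE = - (ch mE * ch mF)"
  "ch mU * ch mE = - (ch mE * ch mU)" "ch mU * ch mF = - (ch mF * ch mU)"
proof -
  have zero: "z = 0" if "z = - z" for z :: "'g chain_algebra"
    using that by (metis add.right_inverse scaleR_2 scaleR_eq_0_iff zero_neq_numeral)
  show "ch mE * ch mE = 0" "ch mF * ch mF = 0"
    using chain_commute[OF basis_grades(1,1)] chain_commute[OF basis_grades(2,2)] by (auto intro!: zero)
qed (use chain_commute basis_grades in fastforce)+

definition monomial :: "bool \<Rightarrow> bool \<Rightarrow> nat \<Rightarrow> 'g chain_algebra" where
  "monomial a b k = (if a then ch mE else 1) * (if b then ch mF else 1) * ch mU ^ k"

lemma ch_monomial:
  "ch mE * monomial a b k = (if a then 0 else monomial True b k)"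
  "ch mF * monomial a b k = (if b then 0 else (if a then -1 else 1) *\<^sub>R monomial a True k)"
  "ch mU * monomial a b k = (if a = b then 1 else -1) *\<^sub>R monomial a b (Suc k)"
proof -
  have left: "ch mE * (ch mE * z) = 0" "ch mF * (ch mF * z) = 0" "ch mF * (ch mE * z) = - (ch mE * (ch mF * z))"
    "ch mU * (ch mE * z) = - (ch mE * (ch mU * z))" "ch mU * (ch mF * z) = - (ch mF * (ch mU * z))" for z
    by (simp_all add: mult.assoc[symmetric] ch_relations)
  show "ch mE * monomial a b k = (if a then 0 else monomial True b k)"
  "ch mF * monomial a b k = (if b then 0 else (if a then -1 else 1) *\<^sub>R monomial a True k)"
  "ch mU * monomial a b k = (if a = b then 1 else -1) *\<^sub>R monomial a b (Suc k)"
    by (cases a; cases b; simp add: monomial_def mult.assoc ch_relations left)+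
qed

definition chain_op :: "'g multivector \<Rightarrow> model \<Rightarrow> model" where
  "chain_op X w = cE X *\<^sub>R mult_e w + cF X *\<^sub>R mult_f w + cU X *\<^sub>R mult_u w"

lemma bilinear_chain_op: "bilinear chain_op"
  unfolding bilinear_def by (intro conjI allI linearI) (simp_all add: chain_op_def algebra_simps)

lemmas chain_op_linearity [simp] =
  bilinear_ladd[OF bilinear_chain_op] bilinear_lmul[OF bilinear_chain_op]
  bilinear_radd[OF bilinear_chain_op] bilinear_rmul[OF bilinear_chain_op]
  bilinear_lzero[OF bilinear_chain_op] bilinear_rzero[OF bilinear_chain_op]

text \<open>
  The multiplications on the model satisfy the relations of the chain algebra, hence \<open>chain_act\<close> below is an action.
\<close>

lemma chain_op_commute:
  assumes "X \<in> grade_space x" "Y \<in> grade_space y"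
  shows "chain_op X (chain_op Y w) + (-1) ^ (x * y) *\<^sub>R chain_op Y (chain_op X w) = 0"
  using grade_space_cases[OF assms(1)] grade_space_cases[OF assms(2)]
  by (elim disjE conjE; simp only: chain_op_linearity; simp add: chain_op_def mult_relations algebra_simps)

lemmas chain_act_props = algebra_action_chain_act[OF bilinear_chain_op chain_op_commute]
  chain_act_gen[OF bilinear_chain_op chain_op_commute]

definition to_model :: "'g chain_algebra \<Rightarrow> model" where
  "to_model c = chain_act chain_op c (mon False False 0)"

definition of_model :: "model \<Rightarrow> 'g chain_algebra" where
  "of_model = lin_ext (\<lambda>(a, b, k). monomial a b k)"

lemma of_model_mon [simp]: "of_model (mon a b k) = monomial a b k"
  by (simp add: of_model_def)

lemma linear_of_model: "linear of_model"
  unfolding of_model_def by (rule linear_lin_ext)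

lemma linear_to_model: "linear to_model"
proof -
  have "bilinear (chain_act chain_op)"
    using chain_act_props(1) by (simp add: algebra_action_def)
  then show ?thesis
    by (intro linearI) (simp_all add: to_model_def bilinear_ladd bilinear_lmul)
qed

lemma to_model_1: "to_model 1 = mon False False 0"
  using chain_act_props(1) by (simp add: to_model_def algebra_action_def)

lemma to_model_ch: "to_model (ch X * c) = chain_op X (to_model c)"
  using chain_act_props by (simp add: to_model_def algebra_action_def)

lemmas model_maps_linearity [simp] =
  linear_of_model[THEN linear_add] linear_of_model[THEN linear_scale] linear_of_model[THEN linear_0]
  linear_to_model[THEN linear_add] linear_to_model[THEN linear_scale] linear_to_model[THEN linear_0]

lemma of_model_op: "of_model (chain_op X w) = ch X * of_model w"
proof (induction w rule: model_induct)
  case (add v w)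
  then show ?case by (simp add: distrib_left)
next
  case (scaleR c w)
  then show ?case by simp
qed (subst ch_expand; simp add: chain_op_def ch_monomial distrib_right linear_neg[OF linear_of_model] linear_diff[OF linear_of_model])+

text \<open>
  \<open>of_model\<close> turns the multiplication operators into multiplication in the chain algebra, so the two maps
  cancel on every product of generators, and such products span. This is why the monomials span the chain algebra.
\<close>

lemma of_to_model: "of_model (to_model c) = c"
proof -
  have "of_model (to_model (chain_prod Ys)) = chain_prod Ys" for Ys
  proof (induction Ys)
    case Nil
    then show ?case by (simp add: chain_prod_Nil to_model_1 monomial_def)
  next
    case (Cons Y Ys)
    then show ?case by (simp add: chain_prod_Cons to_model_ch of_model_op)
  qed
  moreover have "linear (\<lambda>c. of_model (to_model c))" "linear (\<lambda>c :: 'g chain_algebra. c)"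
    by (auto intro!: linearI)
  moreover have "c \<in> span (range chain_prod)"
    by (simp add: span_chain_prod)
  ultimately show ?thesis
    using linear_eq_on_span[of "\<lambda>c. of_model (to_model c)" "\<lambda>c. c" "range chain_prod" c] by blast
qed

lemma to_model_monomial: "to_model (monomial a b k) = mon a b k"
proof -
  have basis: "chain_op mE w = mult_e w" "chain_op mF w = mult_f w" "chain_op mU w = mult_u w" for w
    by (simp_all add: chain_op_def ext_coord_ext ext_coord_ef)
  have "to_model (ch mU ^ k) = mon False False k"
    by (induction k) (simp_all add: to_model_1 to_model_ch basis)
  then show ?thesis
    by (cases a; cases b; simp add: monomial_def mult.assoc to_model_ch basis)
qed

section \<open>The boundary operator\<close>

definition ad :: "'g multivector \<Rightarrow> model \<Rightarrow> model" where
  "ad X w = cE X *\<^sub>R ad_e w + cF X *\<^sub>R ad_f w + cU X *\<^sub>R ad_u w"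

lemma model_boundary_chain_op: "model_boundary (chain_op X w) = ad X w - chain_op X (model_boundary w)"
  by (simp add: chain_op_def ad_def model_boundary_mult algebra_simps)

lemma coords_bracket: "cE (bracket X Y) = 0" "cF (bracket X Y) = cE X * cF Y - cF X * cE Y"
  "cU (bracket X Y) = cE X * cU Y - cU X * cE Y"
  by (simp_all add: bracket_def ext_coord_ext ext_coord_ef)

lemma ad_even:
  assumes "cU X = 0"
  shows "ad X (mult_e w) = mult_e (ad X w) - cF X *\<^sub>R mult_f w"
    "ad X (mult_f w) = cE X *\<^sub>R mult_f w + mult_f (ad X w)"
    "ad X (mult_u w) = cE X *\<^sub>R mult_u w + mult_u (ad X w)"
  using assms by (simp_all add: ad_def ad_mult algebra_simps)

lemma ad_odd:
  assumes "cE X = 0" "cF X = 0"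
  shows "ad X (mult_e w) = mult_e (ad X w) - cU X *\<^sub>R mult_u w"
    "ad X (mult_f w) = mult_f (ad X w)"
    "ad X (mult_u w) = - mult_u (ad X w)"
  using assms by (simp_all add: ad_def ad_mult algebra_simps)

lemma linear_ad: "linear (ad X)"
  by (rule linearI) (simp_all add: ad_def algebra_simps)

text \<open>
  The superderivation rule on homogeneous elements: for nonzero \<open>X\<close> and \<open>Y\<close> the sign is \<open>-1\<close> only if \<open>X\<close> and \<open>Y\<close> are both
  multiples of \<open>u\<close>, and for zero factors, which belong to every grade, both sides vanish.
\<close>

lemma ad_chain_op:
  assumes X: "X \<in> grade_space x" and Y: "Y \<in> grade_space y"
  shows "ad X (chain_op Y w) = chain_op (bracket X Y) w + (-1) ^ (x * y) *\<^sub>R chain_op Y (ad X w)"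
proof -
  have expand: "ad X (chain_op Y w) = cE Y *\<^sub>R ad X (mult_e w) + cF Y *\<^sub>R ad X (mult_f w) + cU Y *\<^sub>R ad X (mult_u w)"
    by (simp add: chain_op_def linear_add[OF linear_ad] linear_scale[OF linear_ad])
  consider "X = 0" | "Y = 0" | "x = 0" "cU X = 0" | "x = 1" "cE X = 0" "cF X = 0" "y = 0" "cU Y = 0"
    | "x = 1" "cE X = 0" "cF X = 0" "y = 1" "cE Y = 0" "cF Y = 0"
    using grade_space_cases[OF X] grade_space_cases[OF Y] by blast
  then show ?thesis
  proof cases
    case 1
    then show ?thesis by (simp add: ad_def bilinear_lzero[OF bilinear_bracket])
  next
    case 2
    then show ?thesis by (simp add: linear_0[OF linear_ad] bilinear_rzero[OF bilinear_bracket])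
  next
    case 3
    show ?thesis
      unfolding expand unfolding ad_even[OF 3(2)] chain_op_def coords_bracket
      using 3 by (simp add: algebra_simps)
  next
    case 4
    show ?thesis
      unfolding expand unfolding ad_odd[OF 4(2,3)] chain_op_def coords_bracket
      using 4 by (simp add: algebra_simps)
  next
    case 5
    show ?thesis
      unfolding expand unfolding ad_odd[OF 5(2,3)] chain_op_def coords_bracket
      using 5 by (simp add: algebra_simps)
  qed
qed

text \<open>
  The part of the boundary sum of \<open>Z # Ys\<close> in which the first factor \<open>Z\<close> is bracketed with a later one;
  equivalently, the superderivation extending the bracket with \<open>Z\<close>, written as a sum over the factors.
\<close>

definition ad_sum :: "'g multivector \<Rightarrow> nat \<Rightarrow> 'g multivector list \<Rightarrow> nat list \<Rightarrow> 'g chain_algebra" where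
  "ad_sum Z z Ys ys = (\<Sum>j<length Ys. (-1) ^ (z * (\<Sum>s<j. ys ! s)) *\<^sub>R chain_prod (Ys[j := bracket Z (Ys ! j)]))"

definition boundary_sum :: "'g multivector list \<Rightarrow> nat list \<Rightarrow> 'g chain_algebra" where
  "boundary_sum Ys ys = (\<Sum>j<length Ys. \<Sum>i<j.
     (-1) ^ (i + ys ! i * (\<Sum>s\<in>{i<..<j}. ys ! s)) *\<^sub>R
       chain_prod (omit i (Ys[j := bracket (Ys ! i) (Ys ! j)])))"

lemma ad_sum_Cons:
  "ad_sum Z z (Y # Ys) (y # ys) =
     ch (bracket Z Y) * chain_prod Ys + (-1) ^ (z * y) *\<^sub>R (ch Y * ad_sum Z z Ys ys)"
  unfolding ad_sum_def length_Cons sum.lessThan_Suc_shift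
  by (simp add: chain_prod_Cons sum_distrib_left scaleR_sum_right power_add distrib_left
      flip: mult_scaleR_right scaleR_scaleR)

text \<open>
  The pairs \<open>i < j\<close> with \<open>i = 0\<close> give \<open>ad_sum\<close>. In the remaining pairs both indices move
  by one, which changes the sign \<open>(-1)\<^sup>i\<close> and nothing else.
\<close>

lemma boundary_sum_Cons:
  "boundary_sum (Z # Ys) (z # ys) = ad_sum Z z Ys ys - ch Z * boundary_sum Ys ys"
proof -
  have shift: "(\<Sum>s\<in>{Suc i<..<Suc j}. (z # ys) ! s) = (\<Sum>s\<in>{i<..<j}. ys ! s)" for i j
    by (rule sum.reindex_cong[of Suc]) (auto simp: image_iff gr0_conv_Suc Suc_less_eq2)
  have shift0: "(\<Sum>s\<in>{0<..<Suc j}. (z # ys) ! s) = (\<Sum>s<j. ys ! s)" for j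
    by (rule sum.reindex_cong[of Suc]) (auto simp: image_iff gr0_conv_Suc)
  have omit_Suc: "omit (Suc i) (Z # Ys) = Z # omit i Ys" and omit_0: "omit 0 (Z # Ys) = Ys" for i and Ys :: "'g multivector list"
    by (simp_all add: omit_def)
  have "boundary_sum (Z # Ys) (z # ys) =
      (\<Sum>j<length Ys. (-1) ^ (z * (\<Sum>s<j. ys ! s)) *\<^sub>R chain_prod (Ys[j := bracket Z (Ys ! j)]) +
        (\<Sum>i<j. - ((-1) ^ (i + ys ! i * (\<Sum>s\<in>{i<..<j}. ys ! s)) *\<^sub>R
          (ch Z * chain_prod (omit i (Ys[j := bracket (Ys ! i) (Ys ! j)]))))))"
    by (simp only: boundary_sum_def length_Cons sum.lessThan_Suc_shift lessThan_0 sum.empty add_0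
        nth_Cons_0 nth_Cons_Suc list_update_code shift shift0 omit_Suc omit_0 chain_prod_Cons
        add_Suc power_Suc mult_minus1 scaleR_minus_left)
  then show ?thesis
    by (simp only: ad_sum_def boundary_sum_def sum.distrib sum_negf sum_subtractf sum_distrib_left[of "ch Z"]
        mult_scaleR_right add_uminus_conv_diff)
qed

lemma to_model_ad_sum:
  assumes "Z \<in> grade_space z" "has_grades Ys ys"
  shows "to_model (ad_sum Z z Ys ys) = ad Z (to_model (chain_prod Ys))"
  using assms(2) unfolding has_grades_def
proof (induction rule: list_all2_induct)
  case Nil
  then show ?case
    by (simp add: ad_sum_def chain_prod_Nil to_model_1 ad_def)
next
  case (Cons Y Ys y ys)
  then show ?case
    by (simp add: ad_sum_Cons chain_prod_Cons to_model_ch ad_chain_op[OF assms(1)])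
qed

text \<open>
  This is the well-definedness of the boundary operator: the sum on the left depends only on the product of the factors.
\<close>

lemma to_model_boundary_sum:
  assumes "has_grades Ys ys"
  shows "to_model (boundary_sum Ys ys) = model_boundary (to_model (chain_prod Ys))"
  using assms unfolding has_grades_def
proof (induction rule: list_all2_induct)
  case Nil
  then show ?case
    by (simp add: boundary_sum_def chain_prod_Nil to_model_1)
next
  case (Cons Y Ys y ys)
  then show ?case
    by (simp add: boundary_sum_Cons chain_prod_Cons to_model_ch to_model_ad_sum has_grades_def model_boundary_chain_op
        linear_diff[OF linear_to_model])
qed

text \<open>
  Monomials are products of homogeneous factors. This gives the uniqueness of the boundary operator, as
  they span, and places them in the spaces of chains of given weight.
\<close>

lemma monomial_homogeneous:
  "\<exists>Ys ys. has_grades Ys ys \<and> length Ys = of_bool a + of_bool b + k \<and> sum_list ys = k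
     \<and> monomial a b k = chain_prod Ys"
proof -
  let ?Ys = "(if a then [mE] else []) @ (if b then [mF] else []) @ replicate k mU"
  let ?ys = "(if a then [0] else []) @ (if b then [0] else []) @ replicate k 1"
  have "chain_prod (replicate k mU) = ch mU ^ k"
    by (induction k) (simp_all add: chain_prod_Nil chain_prod_Cons)
  then have "monomial a b k = chain_prod ?Ys"
    by (simp add: monomial_def chain_prod_Cons mult.assoc)
  moreover have "list_all2 (\<lambda>Y y. Y \<in> grade_space y) (replicate k mU) (replicate k 1)"
    using basis_grades by (induction k) simp_all
  then have "has_grades ?Ys ?ys"
    using basis_grades by (simp add: has_grades_def)
  moreover have "length ?Ys = of_bool a + of_bool b + k" "sum_list ?ys = k"
    by (simp_all add: sum_list_replicate)
  ultimately show ?thesis by blast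
qed

text \<open>
  Existence of the boundary operator is the well-definedness in \<open>to_model_boundary_sum\<close>;
  uniqueness holds because the defining formula fixes the values on monomials, which span.
\<close>

lemma boundary_eq: "boundary br = of_model \<circ> model_boundary \<circ> to_model"
  unfolding boundary_def schouten_eq boundary_sum_def[symmetric]
proof (rule the_equality, intro conjI allI impI)
  show lin: "linear (of_model \<circ> model_boundary \<circ> to_model)"
    by (intro linear_compose linear_model_maps linear_to_model linear_of_model)
  show spec: "(of_model \<circ> model_boundary \<circ> to_model) (chain_prod Ys) = boundary_sum Ys ys" if "has_grades Ys ys" for Ys ys
    by (simp add: to_model_boundary_sum[OF that, symmetric] of_to_model)
  fix D :: "'g chain_algebra \<Rightarrow> 'g chain_algebra"
  assume D: "linear D \<and> (\<forall>Ys ys. has_grades Ys ys \<longrightarrow> D (chain_prod Ys) = boundary_sum Ys ys)"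
  have "D (of_model w) = (of_model \<circ> model_boundary \<circ> to_model) (of_model w)" for w
  proof (rule linear_eq_on_singles)
    show "linear (\<lambda>w. D (of_model w))" "linear (\<lambda>w. (of_model \<circ> model_boundary \<circ> to_model) (of_model w))"
      using linear_compose[OF linear_of_model, of D] linear_compose[OF linear_of_model lin] D
      by (simp_all add: o_def)
    fix i :: "bool \<times> bool \<times> nat"
    obtain a b k where i: "i = (a, b, k)" by (cases i)
    show "D (of_model (Poly_Mapping.single i 1)) = (of_model \<circ> model_boundary \<circ> to_model) (of_model (Poly_Mapping.single i 1))"
      using monomial_homogeneous[of a b k] D spec by (auto simp: i simp del: o_apply)
  qed
  then show "D = of_model \<circ> model_boundary \<circ> to_model"
    by (metis ext of_to_model)
qed

lemma boundary_monomial: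
  "boundary br (monomial a b k) = (if a then (of_bool b + real k) *\<^sub>R monomial False b k else 0)"
  by (simp add: boundary_eq to_model_monomial)

end


section \<open>Dimensions and Betti numbers\<close>

context nonabelian_plane
begin

text \<open>
  The map \<open>to_model\<close> sends distinct monomials to distinct basis elements of the model, whose coordinates isolate each coefficient.
\<close>

lemma independent_monomials: "independent ((\<lambda>(a, b). monomial a b w) ` A)"
proof (rule ccontr)
  assume "\<not> independent ((\<lambda>(a, b). monomial a b w) ` A)"
  then obtain T u v where T: "finite T" "T \<subseteq> (\<lambda>(a, b). monomial a b w) ` A"
    and sum: "(\<Sum>v\<in>T. u v *\<^sub>R v) = 0" and v: "v \<in> T" "u v \<noteq> (0 :: real)"
    unfolding dependent_explicit by blast
  obtain a b where ab: "v = monomial a b w"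
    using T v by auto
  have coeff: "Poly_Mapping.lookup (to_model y) (a, b, w) = (if y = v then 1 else 0)" if "y \<in> T" for y
  proof -
    obtain a' b' where y: "y = monomial a' b' w"
      using T(2) \<open>y \<in> T\<close> by fastforce
    have "y = v \<longleftrightarrow> a' = a \<and> b' = b"
    proof
      assume "y = v"
      then have "to_model y = to_model v" by simp
      then show "a' = a \<and> b' = b"
        unfolding y ab to_model_monomial by (auto dest: arg_cong[where f = Poly_Mapping.keys])
    qed (simp add: y ab)
    then show ?thesis
      by (auto simp: y to_model_monomial lookup_single when_def)
  qed
  have "Poly_Mapping.lookup (to_model (\<Sum>v\<in>T. u v *\<^sub>R v)) (a, b, w) = (\<Sum>y\<in>T. if y = v then u y else 0)"
    by (auto simp: linear_sum[OF linear_to_model] lookup_sum coeff intro!: sum.cong)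
  then show False
    using T v sum by simp
qed

lemma inj_monomial: "inj (\<lambda>(a, b). monomial a b w)"
proof (rule injI, clarify)
  fix a b a' b'
  assume "monomial a b w = monomial a' b' w"
  then have "mon a b w = mon a' b' w"
    by (metis to_model_monomial)
  then show "a = a' \<and> b = b'"
    by (auto dest: arg_cong[where f = Poly_Mapping.keys])
qed

lemma dim_monomials: "dim (span ((\<lambda>(a, b). monomial a b w) ` A)) = card A"
  by (simp only: dim_span_eq_card_independent[OF independent_monomials]
      card_image[OF inj_on_subset[OF inj_monomial subset_UNIV]])

definition exponents :: "nat \<Rightarrow> (bool \<times> bool) set" where
  "exponents n = {(a, b). of_bool a + of_bool b = n}"

lemma exponents_simps:
  "exponents 0 = {(False, False)}" "exponents 1 = {(True, False), (False, True)}"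
  "exponents 2 = {(True, True)}" "exponents 3 = {}"
  by (auto simp: exponents_def of_bool_def split: if_splits)

text \<open>
  A homogeneous generator maps the span of the monomials of length \<open>m\<close> and weight \<open>v\<close> to the span
  of those of length \<open>m + 1\<close> with its grade added to the weight; hence products of homogeneous factors stay in these spans.
\<close>

lemma weight_chains_eq:
  "weight_chains (w + n) w = span ((\<lambda>(a, b). monomial a b w) ` exponents n)"
proof
  define S where "S m w = span {monomial a b w | a b. of_bool a + of_bool b + w = m}" for m w
  have mem: "monomial a b v \<in> S m v" if "of_bool a + of_bool b + v = m" for a b m v
    unfolding S_def using that by (intro span_base) blast
  have sub: "subspace (S m v)" for m v
    by (simp add: S_def)
  note closed = subspace_0[OF sub] subspace_add[OF sub] subspace_scale[OF sub] subspace_neg[OF sub]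
  have step: "ch Y * c \<in> S (Suc m) (y + v)" if Y: "Y \<in> grade_space y" and c: "c \<in> S m v" for Y y c m v
    using c unfolding S_def[of m v]
  proof (induction rule: span_induct_alt)
    case base
    then show ?case by (simp add: closed)
  next
    case (step r x z)
    then obtain a b where x: "x = monomial a b v" and m: "m = of_bool a + of_bool b + v"
      by auto
    have "ch Y * x \<in> S (Suc m) (y + v)"
      using grade_space_cases[OF Y]
    proof (elim disjE conjE)
      assume "y = 0" "cU Y = 0"
      then show ?thesis
        by (subst ch_expand) (cases a; cases b; simp add: x m distrib_right ch_monomial closed mem)
    next
      assume "y = 1" "cE Y = 0" "cF Y = 0"
      then show ?thesis
        by (subst ch_expand) (simp add: x m ch_monomial closed mem)
    next
      assume "Y = 0"
      then show ?thesis
        by (simp add: linear_0[OF linear_ch] closed)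
    qed
    then show ?case
      using step by (simp add: distrib_left closed)
  qed
  have "chain_prod Ys \<in> S (length Ys) (sum_list ys)" if "has_grades Ys ys" for Ys ys
    using that unfolding has_grades_def
  proof (induction rule: list_all2_induct)
    case Nil
    have "monomial False False 0 \<in> S 0 0"
      by (rule mem) simp
    then show ?case
      by (simp add: chain_prod_Nil monomial_def)
  next
    case (Cons Y Ys y ys)
    then show ?case
      using step by (simp add: chain_prod_Cons)
  qed
  then have "weight_chains (w + n) w \<subseteq> S (w + n) w"
    unfolding weight_chains_def by (intro span_minimal sub) (clarify, metis)
  also have "S (w + n) w = span ((\<lambda>(a, b). monomial a b w) ` exponents n)"
  proof -
    have image: "{g a b | a b. P a b} = (\<lambda>(a, b). g a b) ` {(a, b). P a b}"
      for g :: "bool \<Rightarrow> bool \<Rightarrow> 'g chain_algebra" and P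
      by auto
    show ?thesis
      unfolding S_def exponents_def image by (simp only: add.commute[of _ w] add_left_cancel)
  qed
  finally show "weight_chains (w + n) w \<subseteq> span ((\<lambda>(a, b). monomial a b w) ` exponents n)" .
  show "span ((\<lambda>(a, b). monomial a b w) ` exponents n) \<subseteq> weight_chains (w + n) w"
    unfolding weight_chains_def
  proof (rule span_mono, clarify)
    fix a b
    assume "(a, b) \<in> exponents n"
    then show "\<exists>Ys ys. monomial a b w = chain_prod Ys \<and> has_grades Ys ys \<and> length Ys = w + n \<and> sum_list ys = w"
      using monomial_homogeneous[of a b w] by (auto simp: exponents_def add.commute)
  qed
qed

lemma weight_chains_simps:
  "weight_chains w w = span {monomial False False w}"
  "weight_chains (w + 1) w = span {monomial True False w, monomial False True w}"
  "weight_chains (w + 2) w = span {monomial True True w}"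
  "(weight_chains (w + 3) w :: 'g chain_algebra set) = {0}"
  using weight_chains_eq[of w 0] weight_chains_eq[of w 1] weight_chains_eq[of w 2] weight_chains_eq[of w 3]
  unfolding exponents_simps by simp_all

lemma linear_boundary: "linear (boundary br)"
  unfolding boundary_eq by (intro linear_compose linear_model_maps linear_to_model linear_of_model)

lemma monomial_nonzero: "monomial a b k \<noteq> 0"
  by (metis linear_0 linear_to_model lookup_single_eq lookup_zero to_model_monomial zero_neq_one)

lemmas boundary_linearity = linear_add[OF linear_boundary] linear_scale[OF linear_boundary]

lemma cycles_w: "cycles br w w = span {monomial False False w}"
  by (auto simp: cycles_def weight_chains_simps span_singleton boundary_linearity boundary_monomial)

lemma cycles_w1:
  assumes "w > 0"
  shows "cycles br (w + 1) w = span {monomial False True w}"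
proof (intro equalityI subsetI)
  fix c assume "c \<in> cycles br (w + 1) w"
  then obtain r s where c: "c = r *\<^sub>R monomial True False w + s *\<^sub>R monomial False True w"
    and "boundary br c = 0"
    unfolding cycles_def weight_chains_simps by (auto simp: span_insert span_singleton algebra_simps)
  then have "r = 0"
    using assms by (simp add: boundary_linearity boundary_monomial monomial_nonzero)
  then show "c \<in> span {monomial False True w}"
    by (simp add: c span_scale span_base)
next
  fix c assume "c \<in> span {monomial False True w}"
  then show "c \<in> cycles br (w + 1) w"
    unfolding cycles_def weight_chains_simps
    using span_mono[of "{monomial False True w}" "{monomial True False w, monomial False True w}"]
    by (auto simp: span_singleton boundary_linearity boundary_monomial)
qed

lemma cycles_w2: "cycles br (w + 2) w = {0}"
proof -
  have "1 + real w \<noteq> 0" by linarith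
  then show ?thesis
    unfolding cycles_def weight_chains_simps
    by (auto simp: span_singleton boundary_linearity boundary_monomial monomial_nonzero span_zero
        linear_0[OF linear_boundary])
qed

text \<open>
  The preimages are \<open>e u\<^sup>w\<close> for \<open>u\<^sup>w\<close>, with factor \<open>w\<close>, and \<open>e f u\<^sup>w\<close> for \<open>f u\<^sup>w\<close>, with factor
  \<open>w + 1\<close>. Only the first factor uses \<open>w > 0\<close> for being nonzero; for \<open>w = 0\<close> the chain \<open>1\<close> would not be a boundary.
\<close>

lemma boundaries_eq_cycles:
  assumes "w > 0"
  shows "boundaries br w w = cycles br w w"
    "boundaries br (w + 1) w = cycles br (w + 1) w"
    "boundaries br (w + 2) w = cycles br (w + 2) w"
proof -
  have scale: "span {c *\<^sub>R z} = span {z}" if "c \<noteq> 0" for c and z :: "'g chain_algebra"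
    using span_image_scale[of "{z}" "\<lambda>_. c"] that by simp
  have Suc_eq: "Suc w = w + 1" "Suc (w + 1) = w + 2" "Suc (w + 2) = w + 3"
    by simp_all
  have next_degree: "weight_chains (Suc w) w = span {monomial True False w, monomial False True w}"
    "weight_chains (Suc (w + 1)) w = span {monomial True True w}"
    "(weight_chains (Suc (w + 2)) w :: 'g chain_algebra set) = {0}"
    by (simp_all only: Suc_eq weight_chains_simps)
  have "span {real w *\<^sub>R monomial False False w, 0} = span {monomial False False w}"
    using scale[of "real w"] assms by (simp add: insert_commute span_insert_0)
  then show "boundaries br w w = cycles br w w"
    unfolding boundaries_def next_degree cycles_w
    by (simp add: linear_span_image[OF linear_boundary, symmetric] boundary_monomial)
  have "1 + real w \<noteq> 0" by linarith
  then show "boundaries br (w + 1) w = cycles br (w + 1) w"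
    unfolding boundaries_def next_degree cycles_w1[OF assms]
    by (simp add: linear_span_image[OF linear_boundary, symmetric] boundary_monomial scale)
  show "boundaries br (w + 2) w = cycles br (w + 2) w"
    unfolding boundaries_def next_degree cycles_w2 by (simp add: linear_0[OF linear_boundary])
qed

end

text \<open>
  Any element \<open>s\<close> of a basis of \<open>Z / Z\<close> would give the relation \<open>1 s \<in> Z\<close>, so the only such basis is empty.
\<close>

lemma quotient_dim_self:
  assumes "0 \<in> Z"
  shows "quotient_dim Z Z = 0"
proof -
  have "S = {}" if S: "quotient_basis Z Z S" for S
  proof (rule ccontr)
    assume "S \<noteq> {}"
    then obtain s where "s \<in> S" by blast
    then have "s \<in> Z"
      using S by (auto simp: quotient_basis_def)
    have "\<forall>t\<in>T. c t = 0" if "finite T" "T \<subseteq> S" "(\<Sum>t\<in>T. c t *\<^sub>R t) \<in> Z" for T c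
      using S that unfolding quotient_basis_def by blast
    from this[of "{s}" "\<lambda>_. 1"] show False
      using \<open>s \<in> S\<close> \<open>s \<in> Z\<close> by simp
  qed
  moreover have "quotient_basis Z Z {}"
    using assms by (auto simp: quotient_basis_def)
  ultimately have "(SOME S. quotient_basis Z Z S) = {}"
    by (metis someI)
  then show ?thesis
    by (simp add: quotient_dim_def)
qed

section \<open>Bases of a nonabelian plane\<close>

text \<open>
  All brackets are multiples of \<open>f = [p, q]\<close> for a basis \<open>p, q\<close>. As \<open>f\<close> is nonzero, \<open>[p, f]\<close> or
  \<open>[q, f]\<close> is a nonzero multiple of \<open>f\<close>, and rescaling \<open>p\<close> or \<open>q\<close> gives \<open>e\<close>.
\<close>

lemma exists_nonabelian_plane:
  fixes br :: "'g::real_vector \<Rightarrow> 'g \<Rightarrow> 'g"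
  assumes "real_lie_algebra br" and dim: "dim (UNIV :: 'g set) = 2" and "\<not> abelian br"
  obtains e f xi eta where "nonabelian_plane br e f xi eta"
proof -
  interpret real_lie_algebra br by fact
  note bil = bilinear_ladd[OF bilinear_br] bilinear_radd[OF bilinear_br]
    bilinear_lmul[OF bilinear_br] bilinear_rmul[OF bilinear_br] bilinear_lzero[OF bilinear_br]
  have anti: "br v w = - br w v" for v w
  proof -
    have "br (v + w) (v + w) = br v v + br v w + (br w v + br w w)"
      by (simp only: bil add_ac)
    then show ?thesis
      by (simp add: alternating eq_neg_iff_add_eq_0)
  qed
  obtain B :: "'g set" where B: "independent B" "UNIV \<subseteq> span B" "card B = dim (UNIV :: 'g set)"
    using basis_exists[of "UNIV :: 'g set"] by metis
  then obtain p q where pq: "B = {p, q}" "p \<noteq> q"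
    using dim by (metis card_2_iff)
  have span_pq: "\<exists>a b. v = a *\<^sub>R p + b *\<^sub>R q" for v
  proof -
    have "v \<in> span {p, q}"
      using B pq by blast
    then show ?thesis
      by (auto simp: span_insert span_singleton) (metis diff_add_cancel add.commute)
  qed
  define f where "f = br p q"
  have "f \<noteq> 0"
  proof
    assume "f = 0"
    then have "br p q = 0" "br q p = 0"
      using anti[of q p] by (simp_all add: f_def)
    then have "br v w = 0" for v w
      using span_pq[of v] span_pq[of w] by (auto simp: bil alternating)
    then show False
      using assms(3) by (simp add: abelian_def)
  qed
  obtain a b where f: "f = a *\<^sub>R p + b *\<^sub>R q"
    using span_pq by blast
  have "br v f = a *\<^sub>R br v p + b *\<^sub>R br v q" for v
    by (simp add: f bil)
  moreover have "br p q = f" "br q p = - f"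
    using anti[of q p] by (simp_all add: f_def)
  ultimately have pf: "br p f = b *\<^sub>R f" and qf: "br q f = - (a *\<^sub>R f)"
    by (simp_all add: alternating)
  have "\<exists>e. br e f = f \<and> p \<in> span {e, f} \<and> q \<in> span {e, f}"
  proof (cases "a = 0")
    case True
    with f \<open>f \<noteq> 0\<close> have "b \<noteq> 0" by auto
    have "br ((1 / b) *\<^sub>R p) f = f"
      using pf \<open>b \<noteq> 0\<close> by (simp add: bil)
    moreover have "p = b *\<^sub>R ((1 / b) *\<^sub>R p)" "q = (1 / b) *\<^sub>R f"
      using \<open>b \<noteq> 0\<close> True by (simp_all add: f)
    ultimately show ?thesis
      by (metis insertI1 insertI2 span_base span_scale)
  next
    case False
    have "br ((- 1 / a) *\<^sub>R q) f = f"
      using qf False by (simp add: bil bilinear_lneg[OF bilinear_br])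
    moreover have "q = (- a) *\<^sub>R ((- 1 / a) *\<^sub>R q)"
      using False by simp
    moreover have "p = (1 / a) *\<^sub>R (f - b *\<^sub>R q)"
      using False by (simp add: f)
    ultimately show ?thesis
      by (metis insertI1 insertI2 span_base span_diff span_scale)
  qed
  then obtain e where e: "br e f = f" "p \<in> span {e, f}" "q \<in> span {e, f}"
    by blast
  have "e \<noteq> f"
    using e(1) \<open>f \<noteq> 0\<close> alternating by metis
  have "e \<notin> span {f}"
    using e(1) \<open>f \<noteq> 0\<close> by (auto simp: span_singleton bil alternating)
  then have ind: "independent {e, f}"
    using \<open>f \<noteq> 0\<close> \<open>e \<noteq> f\<close> by (simp add: independent_insert)
  obtain xi :: "'g \<Rightarrow> real" where xi: "linear xi" "xi e = 1" "xi f = 0"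
    using linear_independent_extend[OF ind, of "\<lambda>v. if v = e then 1 else 0"] \<open>e \<noteq> f\<close> by auto
  obtain eta :: "'g \<Rightarrow> real" where eta: "linear eta" "eta e = 0" "eta f = 1"
    using linear_independent_extend[OF ind, of "\<lambda>v. if v = f then 1 else 0"] \<open>e \<noteq> f\<close> by auto
  have expand: "v = xi v *\<^sub>R e + eta v *\<^sub>R f" for v
  proof -
    have "v \<in> span {e, f}"
      using span_pq[of v] e by (auto intro: span_add span_scale)
    then obtain r s where "v = r *\<^sub>R e + s *\<^sub>R f"
      by (auto simp: span_insert span_singleton) (metis diff_add_cancel add.commute)
    then show ?thesis
      using xi eta by (simp add: linear_add linear_scale)
  qed
  show thesis
    by (rule that[OF nonabelian_plane.intro[OF assms(1) nonabelian_plane_axioms.intro]])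
      (fact xi eta e(1) dim expand)+
qed

theorem mainTheorem1:
  fixes br :: "'g::real_vector \<Rightarrow> 'g \<Rightarrow> 'g" and w :: nat
  assumes "real_lie_algebra br"
    and "dim (UNIV :: 'g set) = 2"
    and "\<not> abelian br"
    and "w > 0"
  shows
    "dim (weight_chains w w :: 'g chain_algebra set) = 1 \<and>
     dim (weight_chains (w + 1) w :: 'g chain_algebra set) = 2 \<and>
     dim (weight_chains (w + 2) w :: 'g chain_algebra set) = 1 \<and>
     dim (cycles br w w) = 1 \<and>
     dim (cycles br (w + 1) w) = 1 \<and>
     dim (cycles br (w + 2) w) = 0 \<and>
     betti br w w = 0 \<and>
     betti br (w + 1) w = 0 \<and>
     betti br (w + 2) w = 0"
proof -
  obtain e f xi eta where "nonabelian_plane br e f xi eta"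
    using exists_nonabelian_plane assms by blast
  then interpret nonabelian_plane br e f xi eta .
  have dims: "dim (span {monomial a b w}) = 1" for a b
    using dim_monomials[of w "{(a, b)}"] by simp
  have dim2: "dim (span {monomial True False w, monomial False True w}) = 2"
    using dim_monomials[of w "{(True, False), (False, True)}"] by simp
  have "betti br m w = 0" if "boundaries br m w = cycles br m w" "0 \<in> cycles br m w" for m
    unfolding betti_def that(1) by (rule quotient_dim_self) fact
  then have "betti br w w = 0" "betti br (w + 1) w = 0" "betti br (w + 2) w = 0"
    using boundaries_eq_cycles[OF assms(4)] cycles_w[of w] cycles_w1[OF assms(4)] cycles_w2[of w]
    by (auto simp: span_zero)
  moreover have "dim {0 :: 'g chain_algebra} = 0"
    using dim_monomials[of w "{}"] by (simp only: image_empty span_empty card.empty)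
  ultimately show ?thesis
    unfolding cycles_w cycles_w1[OF assms(4)] cycles_w2 weight_chains_simps
    by (simp only: dims dim2 simp_thms)
qed

end
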